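(* There exists a family $(p_t)_{t\in[0,1]}$ of nontrivial orthogonal projections on $H^2$, continuous in $t$ with respect to the operator norm and such that $p_t(H^2)$ is invariant under $M_z$ for each $t\in[0,1]$, for which there is no cross section of $p_t$ in $\mathfrak{I}$ that is continuous in the supremum norm; that is, there is no map $t\mapsto\varphi_t$ from $[0,1]$ to $\mathfrak{I}$, continuous with respect to $\|\cdot\|_{\infty}$, such that $p_t(H^2)=\varphi_t H^2$ for every $t\in[0,1]$.
   Context: $\mathbb{D}$ is the open unit disc, $\mathbb{T}$ the unit circle, $H^{\infty}$ the Banach algebra of bounded analytic functions on $\mathbb{D}$ with the supremum norm $\|f\|_{\infty}=\sup_{z\in\mathbb{D}}|f(z)|$. $H^2$ is the classical Hardy space on $\mathbb{D}$, and $M_z$ is the operator of multiplication by the coordinate function $z$ on $H^2$. A projection on $H^2$ is nontrivial if it is neither $0$ nor the identity. An inner function is a bounded analytic function on $\mathbb{D}$ with unimodular radial limits almost everywhere on $\mathbb{T}$; $\mathfrak{I}$ is the set of all inner functions. By Beurling's theorem, if $p$ is a nontrivial orthogonal projection on $H^2$ with $p(H^2)$ invariant under $M_z$, then $p(H^2)=\varphi H^2$ for some inner function $\varphi$, unique up to a scalar of modulus $1$. For a family $(p_t)_{t\in[0,1]}$ of such projections, a choice of inner functions $\varphi_t$ with $p_t(H^2)=\varphi_tH^2$ for each $t$ is called a cross section of $p_t$ in $\mathfrak{I}$ (no normalization of $\varphi_t$ is required). *)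

theory Defs
  imports "HOL-Complex_Analysis.Complex_Analysis"
begin

section \<open>Square means and Taylor coefficients on the unit disc\<close>

definition mean_sq :: "(complex \<Rightarrow> complex) \<Rightarrow> real \<Rightarrow> real"
  where "mean_sq f r =
    1 / (2 * pi) * integral {0..2 * pi} (\<lambda>t. (cmod (f (complex_of_real r * cis t)))\<^sup>2)"

definition taylor_coeff :: "(complex \<Rightarrow> complex) \<Rightarrow> nat \<Rightarrow> complex"
  where "taylor_coeff f n = (deriv ^^ n) f 0 / fact n"

lemma taylor_coeff_sums:
  assumes "f holomorphic_on ball 0 1" "z \<in> ball 0 1"
  shows "(\<lambda>n. taylor_coeff f n * z ^ n) sums f z"
  using holomorphic_power_series[OF assms] by (simp add: taylor_coeff_def)

lemma integral_cis_orthogonal: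
  fixes m n :: nat
  assumes "m \<noteq> n"
  shows "((\<lambda>t. cis (real m * t) * cnj (cis (real n * t))) has_integral 0) {0..2 * pi}"
proof -
  define k where "k = real m - real n"
  have k: "k \<noteq> 0" using assms by (simp add: k_def)
  have eq: "cis (real m * t) * cnj (cis (real n * t)) = exp (\<i> * of_real (k * t))" for t
  proof -
    have "cis (real m * t) * cnj (cis (real n * t)) = cis (k * t)"
      by (simp add: cis_cnj cis_mult k_def algebra_simps)
    thus ?thesis by (simp add: cis_conv_exp)
  qed
  let ?F = "\<lambda>t. exp (\<i> * of_real (k * t)) / (\<i> * of_real k)"
  have "((\<lambda>t. exp (\<i> * of_real (k * t))) has_integral (?F (2 * pi) - ?F 0)) {0..2 * pi}"
  proof (rule fundamental_theorem_of_calculus)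
    fix t :: real
    have "((\<lambda>z. exp (c * z) / c) has_field_derivative exp (c * of_real t)) (at (of_real t))"
      if "c \<noteq> 0" for c :: complex
      using that by (auto intro!: derivative_eq_intros)
    from this[of "\<i> * of_real k"] k
    have "((\<lambda>z. exp (\<i> * of_real k * z) / (\<i> * of_real k)) has_field_derivative
      exp (\<i> * of_real k * of_real t)) (at (of_real t))"
      by simp
    from has_vector_derivative_real_field[OF this]
    show "(?F has_vector_derivative exp (\<i> * of_real (k * t))) (at t within {0..2 * pi})"
      by (simp add: has_vector_derivative_at_within mult.assoc)
  qed auto
  moreover have "?F (2 * pi) - ?F 0 = 0"
  proof -
    have "exp (\<i> * of_real (k * (2 * pi))) = 1"
      by (subst exp_eq_1) (auto simp: k_def intro!: exI[of _ "int m - int n"])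
    thus ?thesis by simp
  qed
  ultimately show ?thesis unfolding eq by metis
qed

lemma partial_sum_mean_sq:
  fixes a :: "nat \<Rightarrow> complex"
  shows "((\<lambda>t. (cmod (\<Sum>n<N. a n * cis (real n * t)))\<^sup>2) has_integral
    (2 * pi * (\<Sum>n<N. (cmod (a n))\<^sup>2))) {0..2 * pi}"
proof -
  have summand: "((\<lambda>t. (a m * cnj (a n)) * (cis (real m * t) * cnj (cis (real n * t)))) has_integral
      (if m = n then complex_of_real (2 * pi * (cmod (a n))\<^sup>2) else 0)) {0..2 * pi}" for m n
  proof (cases "m = n")
    case True
    have *: "(a m * cnj (a n)) * (cis (real m * t) * cnj (cis (real n * t)))
        = complex_of_real ((cmod (a n))\<^sup>2)" for t
      by (simp add: True cis_cnj cis_mult complex_norm_square[symmetric])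
    have "((\<lambda>t::real. complex_of_real ((cmod (a n))\<^sup>2)) has_integral
      (measure lborel {0..2 * pi} *\<^sub>R complex_of_real ((cmod (a n))\<^sup>2))) {0..2 * pi}"
      by (rule has_integral_const_real)
    thus ?thesis unfolding * using True by (simp add: scaleR_conv_of_real)
  next
    case False
    show ?thesis
      using has_integral_mult_right[OF integral_cis_orthogonal[OF False], of "a m * cnj (a n)"] False
      by simp
  qed
  have expand: "complex_of_real ((cmod (\<Sum>n<N. a n * cis (real n * t)))\<^sup>2) =
     (\<Sum>m<N. \<Sum>n<N. (a m * cnj (a n)) * (cis (real m * t) * cnj (cis (real n * t))))" for t
    unfolding complex_norm_square by (simp add: sum_product mult_ac)
  have "((\<lambda>t. complex_of_real ((cmod (\<Sum>n<N. a n * cis (real n * t)))\<^sup>2)) has_integral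
     (\<Sum>m<N. \<Sum>n<N. (if m = n then complex_of_real (2 * pi * (cmod (a n))\<^sup>2) else 0))) {0..2 * pi}"
    unfolding expand by (intro has_integral_sum summand) auto
  also have "(\<Sum>m<N. \<Sum>n<N. (if m = n then complex_of_real (2 * pi * (cmod (a n))\<^sup>2) else 0))
     = complex_of_real (2 * pi * (\<Sum>n<N. (cmod (a n))\<^sup>2))"
    by (simp add: sum_distrib_left)
  finally have "((\<lambda>t. complex_of_real ((cmod (\<Sum>n<N. a n * cis (real n * t)))\<^sup>2)) has_integral
     complex_of_real (2 * pi * (\<Sum>n<N. (cmod (a n))\<^sup>2))) {0..2 * pi}" .
  from has_integral_linear[OF this bounded_linear_Re] show ?thesis
    by (simp only: o_def Re_complex_of_real)
qed

lemma mean_sq_sums: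
  assumes f: "f holomorphic_on ball 0 1" and r: "0 \<le> r" "r < 1"
  shows "(\<lambda>n. (cmod (taylor_coeff f n))\<^sup>2 * r ^ (2 * n)) sums mean_sq f r"
proof -
  define a where "a n = taylor_coeff f n * of_real (r ^ n)" for n
  define S where "S N t = (\<Sum>n<N. a n * cis (real n * t))" for N t
  let ?g = "\<lambda>t. f (complex_of_real r * cis t)"
  have sums: "(\<lambda>n. a n * cis (real n * t)) sums ?g t" for t
    using taylor_coeff_sums[OF f, of "of_real r * cis t"] r
    by (simp add: a_def norm_mult power_mult_distrib Complex.DeMoivre mult.assoc)
  have summ: "summable (\<lambda>n. norm (a n))"
  proof -
    define s where "s = (r + 1) / 2"
    have s: "r < s" "s < 1" "0 < s" using r by (auto simp: s_def)
    have "summable (\<lambda>n. taylor_coeff f n * (of_real s) ^ n)"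
      using taylor_coeff_sums[OF f, of "of_real s"] s by (auto simp: sums_iff)
    from powser_insidea[OF this, of "of_real r"] s r show ?thesis
      by (simp add: a_def)
  qed
  have ul: "uniform_limit {0..2 * pi} S ?g sequentially"
  proof -
    have "uniform_limit {0..2 * pi} (\<lambda>N t. \<Sum>n<N. a n * cis (real n * t))
        (\<lambda>t. suminf (\<lambda>n. a n * cis (real n * t))) sequentially"
      by (rule Weierstrass_m_test[OF _ summ]) (simp add: norm_mult)
    also have "(\<lambda>t. suminf (\<lambda>n. a n * cis (real n * t))) = ?g"
      using sums by (auto simp: sums_iff)
    finally show ?thesis unfolding S_def .
  qed
  have cS: "continuous_on {0..2 * pi} (S N)" for N
    unfolding S_def cis_conv_exp by (intro continuous_intros)
  have cg: "continuous_on {0..2 * pi} ?g"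
    by (rule uniform_limit_theorem[OF _ ul]) (auto intro!: eventuallyI cS)
  have bg: "bounded (?g ` {0..2 * pi})"
    by (intro compact_imp_bounded compact_continuous_image cg) auto
  have "uniform_limit {0..2 * pi} (\<lambda>N t. S N t * cnj (S N t)) (\<lambda>t. ?g t * cnj (?g t)) sequentially"
    by (intro bounded_bilinear.bounded_uniform_limit[OF bounded_bilinear_mult]
        ul bg bounded_linear.uniform_limit[OF bounded_linear_cnj])
       (use bg in \<open>auto simp: bounded_iff\<close>)
  hence "uniform_limit {0..2 * pi} (\<lambda>N t. Re (S N t * cnj (S N t))) (\<lambda>t. Re (?g t * cnj (?g t))) sequentially"
    by (rule bounded_linear.uniform_limit[OF bounded_linear_Re])
  hence ul2: "uniform_limit {0..2 * pi} (\<lambda>N t. (cmod (S N t))\<^sup>2) (\<lambda>t. (cmod (?g t))\<^sup>2) sequentially"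
    unfolding complex_norm_square[symmetric] by (simp del: of_real_power)
  obtain I J where IJ: "\<And>N. ((\<lambda>t. (cmod (S N t))\<^sup>2) has_integral I N) {0..2 * pi}"
      "((\<lambda>t. (cmod (?g t))\<^sup>2) has_integral J) {0..2 * pi}" "I \<longlonglongrightarrow> J"
  proof (rule uniform_limit_integral[OF ul2])
    show "continuous_on {0..2 * pi} (\<lambda>t. (cmod (S N t))\<^sup>2)" for N
      by (intro continuous_intros cS)
  qed auto
  have I: "I N = 2 * pi * (\<Sum>n<N. (cmod (a n))\<^sup>2)" for N
    using IJ(1)[of N] partial_sum_mean_sq[where a = a and N = N] unfolding S_def
    by (rule has_integral_unique)
  have J: "J = 2 * pi * mean_sq f r"
    using integral_unique[OF IJ(2)] by (simp add: mean_sq_def)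
  have "(\<lambda>N. 1 / (2 * pi) * I N) \<longlonglongrightarrow> 1 / (2 * pi) * J"
    by (intro tendsto_intros IJ)
  hence "(\<lambda>n. (cmod (a n))\<^sup>2) sums mean_sq f r"
    unfolding sums_def I J by simp
  moreover have "(cmod (a n))\<^sup>2 = (cmod (taylor_coeff f n))\<^sup>2 * r ^ (2 * n)" for n
    using r by (simp add: a_def norm_mult norm_power power_mult_distrib mult.commute flip: power_mult)
  ultimately show ?thesis by simp
qed

lemma mean_sq_nonneg:
  assumes "f holomorphic_on ball 0 1" "0 \<le> r" "r < 1"
  shows "0 \<le> mean_sq f r"
  using assms by (intro sums_le[OF _ sums_zero mean_sq_sums]) auto

lemma mean_sq_sup:
  assumes f: "f holomorphic_on ball 0 1"
  shows "bdd_above (mean_sq f ` {0..<1}) \<longleftrightarrow> summable (\<lambda>n. (cmod (taylor_coeff f n))\<^sup>2)"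
    and "summable (\<lambda>n. (cmod (taylor_coeff f n))\<^sup>2) \<Longrightarrow>
      (SUP r\<in>{0..<1}. mean_sq f r) = (\<Sum>n. (cmod (taylor_coeff f n))\<^sup>2)"
proof -
  let ?c = "\<lambda>n. (cmod (taylor_coeff f n))\<^sup>2"
  have A: "(\<Sum>n<N. ?c n) \<le> C" if C: "\<And>r. 0 \<le> r \<Longrightarrow> r < 1 \<Longrightarrow> mean_sq f r \<le> C" for C N
  proof -
    have lim: "((\<lambda>r::real. \<Sum>n<N. ?c n * r ^ (2 * n)) \<longlongrightarrow> (\<Sum>n<N. ?c n * 1 ^ (2 * n))) (at_left 1)"
      by (intro tendsto_intros)
    have "eventually (\<lambda>r::real. (\<Sum>n<N. ?c n * r ^ (2 * n)) \<le> C) (at_left 1)"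
    proof -
      have "eventually (\<lambda>r::real. r \<in> {0<..<1}) (at_left 1)"
        by (rule eventually_at_left_real) simp
      thus ?thesis
      proof eventually_elim
        case (elim r)
        have "(\<Sum>n<N. ?c n * r ^ (2 * n)) \<le> mean_sq f r"
          using mean_sq_sums[OF f, of r] elim
          by (auto simp: sums_iff dest!: sum_le_suminf[where I = "{..<N}"])
        with C[of r] elim show ?case by simp
      qed
    qed
    from tendsto_upperbound[OF lim this] show ?thesis by simp
  qed
  have A': "summable ?c \<and> suminf ?c \<le> C" if "\<And>r. 0 \<le> r \<Longrightarrow> r < 1 \<Longrightarrow> mean_sq f r \<le> C" for C
  proof
    show "summable ?c" by (rule summableI_nonneg_bounded[where x = C]) (use A that in auto)
    thus "suminf ?c \<le> C" by (rule suminf_le_const) (use A that in auto)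
  qed
  have B: "mean_sq f r \<le> suminf ?c" if "summable ?c" "0 \<le> r" "r < 1" for r
  proof -
    have "?c n * r ^ (2 * n) \<le> ?c n" for n
      using that by (intro mult_left_le) (auto intro: power_le_one)
    with mean_sq_sums[OF f that(2,3)] that(1) show ?thesis
      using suminf_le[of "\<lambda>n. ?c n * r ^ (2 * n)" ?c] by (simp add: sums_iff)
  qed
  show "bdd_above (mean_sq f ` {0..<1}) \<longleftrightarrow> summable ?c"
  proof
    assume "bdd_above (mean_sq f ` {0..<1})"
    then obtain C where "\<And>r. 0 \<le> r \<Longrightarrow> r < 1 \<Longrightarrow> mean_sq f r \<le> C"
      by (force simp: bdd_above_def)
    with A' show "summable ?c" by blast
  next
    assume "summable ?c"
    with B show "bdd_above (mean_sq f ` {0..<1})" by (intro bdd_aboveI[of _ "suminf ?c"]) auto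
  qed
  assume s: "summable ?c"
  show "(SUP r\<in>{0..<1}. mean_sq f r) = suminf ?c"
  proof (rule antisym)
    show "(SUP r\<in>{0..<1}. mean_sq f r) \<le> suminf ?c"
      using B[OF s] by (intro cSUP_least) auto
    have "bdd_above (mean_sq f ` {0..<1})"
      using B[OF s] by (intro bdd_aboveI[of _ "suminf ?c"]) auto
    hence "mean_sq f r \<le> (SUP r\<in>{0..<1}. mean_sq f r)" if "0 \<le> r" "r < 1" for r
      using that by (intro cSUP_upper) auto
    with A' show "suminf ?c \<le> (SUP r\<in>{0..<1}. mean_sq f r)" by blast
  qed
qed


section \<open>The Hardy space\<close>

text \<open>Functions on the disc are represented by total functions vanishing outside of it, so that
  equality in the type is equality on the disc.\<close>

typedef hardy = "{f. f holomorphic_on ball 0 1 \<and> bdd_above (mean_sq f ` {0..<1}) \<and>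
    (\<forall>z. z \<notin> ball 0 1 \<longrightarrow> f z = 0)}"
  morphisms hardy_fun Abs_hardy
proof
  have "mean_sq (\<lambda>_. 0) = (\<lambda>_. 0)" by (simp add: mean_sq_def fun_eq_iff)
  moreover have "bdd_above ((\<lambda>_. 0 :: real) ` {0..<1 :: real})" by (auto intro: bdd_aboveI)
  ultimately show "(\<lambda>_. 0) \<in> {f. f holomorphic_on ball 0 1 \<and> bdd_above (mean_sq f ` {0..<1}) \<and>
    (\<forall>z. z \<notin> ball 0 1 \<longrightarrow> f z = 0)}" by simp
qed

setup_lifting type_definition_hardy

definition hardy_coeff :: "hardy \<Rightarrow> nat \<Rightarrow> complex"
  where "hardy_coeff f = taylor_coeff (hardy_fun f)"

lemma hardy_fun_holomorphic: "hardy_fun f holomorphic_on ball 0 1"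
  and hardy_fun_outside: "z \<notin> ball 0 1 \<Longrightarrow> hardy_fun f z = 0"
  using hardy_fun[of f] by auto

lemma hardy_eqI:
  assumes "\<And>z. z \<in> ball 0 1 \<Longrightarrow> hardy_fun f z = hardy_fun g z"
  shows "f = g"
  by (metis assms ext hardy_fun_inject hardy_fun_outside)

lemma hardy_coeff_square_summable: "summable (\<lambda>n. (cmod (hardy_coeff f n))\<^sup>2)"
  using hardy_fun[of f] mean_sq_sup(1)[of "hardy_fun f"] by (simp add: hardy_coeff_def)

lemma hardy_coeff_sums: "z \<in> ball 0 1 \<Longrightarrow> (\<lambda>n. hardy_coeff f n * z ^ n) sums hardy_fun f z"
  unfolding hardy_coeff_def by (rule taylor_coeff_sums[OF hardy_fun_holomorphic])

lemma taylor_coeff_add: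
  assumes "f holomorphic_on ball 0 1" "g holomorphic_on ball 0 1"
  shows "taylor_coeff (\<lambda>z. f z + g z) n = taylor_coeff f n + taylor_coeff g n"
  unfolding taylor_coeff_def by (subst higher_deriv_add[OF assms]) (auto simp: add_divide_distrib)

lemma taylor_coeff_cmult:
  assumes "f holomorphic_on ball 0 1"
  shows "taylor_coeff (\<lambda>z. c * f z) n = c * taylor_coeff f n"
  unfolding taylor_coeff_def by (subst higher_deriv_cmult[OF assms]) auto

lemma square_summable_add:
  fixes a b :: "nat \<Rightarrow> complex"
  assumes "summable (\<lambda>n. (cmod (a n))\<^sup>2)" "summable (\<lambda>n. (cmod (b n))\<^sup>2)"
  shows "summable (\<lambda>n. (cmod (a n + b n))\<^sup>2)"
proof (rule summable_comparison_test')
  show "summable (\<lambda>n. 2 * (cmod (a n))\<^sup>2 + 2 * (cmod (b n))\<^sup>2)"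
    by (intro summable_add summable_mult assms)
  fix n
  have "(cmod (a n + b n))\<^sup>2 \<le> (cmod (a n) + cmod (b n))\<^sup>2"
    by (intro power_mono norm_triangle_ineq) auto
  also have "\<dots> \<le> 2 * (cmod (a n))\<^sup>2 + 2 * (cmod (b n))\<^sup>2"
    using sum_squares_bound[of "cmod (a n)" "cmod (b n)"] by (simp add: power2_sum)
  finally show "norm ((cmod (a n + b n))\<^sup>2) \<le> 2 * (cmod (a n))\<^sup>2 + 2 * (cmod (b n))\<^sup>2" by simp
qed

lift_definition hardy_scale :: "complex \<Rightarrow> hardy \<Rightarrow> hardy" is "\<lambda>c f z. c * f z"
proof -
  fix c :: complex and f :: "complex \<Rightarrow> complex"
  assume f: "f holomorphic_on ball 0 1 \<and> bdd_above (mean_sq f ` {0..<1}) \<and>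
    (\<forall>z. z \<notin> ball 0 1 \<longrightarrow> f z = 0)"
  hence fh: "f holomorphic_on ball 0 1" and fb: "bdd_above (mean_sq f ` {0..<1})" by auto
  have ch: "(\<lambda>z. c * f z) holomorphic_on ball 0 1" by (intro holomorphic_intros fh)
  have "summable (\<lambda>n. (cmod c)\<^sup>2 * (cmod (taylor_coeff f n))\<^sup>2)"
    using fb unfolding mean_sq_sup(1)[OF fh] by (rule summable_mult)
  hence "bdd_above (mean_sq (\<lambda>z. c * f z) ` {0..<1})"
    unfolding mean_sq_sup(1)[OF ch] by (simp only: taylor_coeff_cmult[OF fh] norm_mult power_mult_distrib)
  with f ch show "(\<lambda>z. c * f z) holomorphic_on ball 0 1 \<and> bdd_above (mean_sq (\<lambda>z. c * f z) ` {0..<1}) \<and>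
    (\<forall>z. z \<notin> ball 0 1 \<longrightarrow> c * f z = 0)" by simp
qed

lift_definition mult_z :: "hardy \<Rightarrow> hardy" is "\<lambda>f z. z * f z"
proof -
  fix f :: "complex \<Rightarrow> complex"
  assume f: "f holomorphic_on ball 0 1 \<and> bdd_above (mean_sq f ` {0..<1}) \<and>
    (\<forall>z. z \<notin> ball 0 1 \<longrightarrow> f z = 0)"
  then obtain C where C: "\<And>r. r \<in> {0..<1} \<Longrightarrow> mean_sq f r \<le> C"
    unfolding bdd_above_def by blast
  have "mean_sq (\<lambda>z. z * f z) r \<le> C" if r: "r \<in> {0..<1}" for r
  proof -
    have "mean_sq (\<lambda>z. z * f z) r = r\<^sup>2 * mean_sq f r"
      by (simp add: mean_sq_def norm_mult power_mult_distrib)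
    also have "\<dots> \<le> 1 * mean_sq f r"
    proof (rule mult_right_mono)
      show "0 \<le> mean_sq f r" using f r by (intro mean_sq_nonneg) auto
    qed (use r in \<open>auto intro: power_le_one\<close>)
    finally show ?thesis using C[OF r] by simp
  qed
  hence "bdd_above (mean_sq (\<lambda>z. z * f z) ` {0..<1})"
    by (intro bdd_aboveI[of _ C]) auto
  with f show "(\<lambda>z. z * f z) holomorphic_on ball 0 1 \<and> bdd_above (mean_sq (\<lambda>z. z * f z) ` {0..<1}) \<and>
    (\<forall>z. z \<notin> ball 0 1 \<longrightarrow> z * f z = 0)"
    by (auto intro!: holomorphic_intros)
qed

text \<open>By \<open>hardy_inner_self\<close> below, this is the inner product inducing the norm defined by the
  square means. It is linear in the first argument.\<close>

definition hardy_inner :: "hardy \<Rightarrow> hardy \<Rightarrow> complex"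
  where "hardy_inner f g = (\<Sum>n. hardy_coeff f n * cnj (hardy_coeff g n))"

lemma hardy_inner_summable: "summable (\<lambda>n. hardy_coeff f n * cnj (hardy_coeff g n))"
proof (rule summable_comparison_test')
  show "summable (\<lambda>n. (cmod (hardy_coeff f n))\<^sup>2 + (cmod (hardy_coeff g n))\<^sup>2)"
    by (intro summable_add hardy_coeff_square_summable)
  fix n
  have "0 \<le> cmod (hardy_coeff f n) * cmod (hardy_coeff g n)" by simp
  moreover have "2 * cmod (hardy_coeff f n) * cmod (hardy_coeff g n)
      \<le> (cmod (hardy_coeff f n))\<^sup>2 + (cmod (hardy_coeff g n))\<^sup>2"
    by (rule sum_squares_bound)
  ultimately show "norm (hardy_coeff f n * cnj (hardy_coeff g n))
      \<le> (cmod (hardy_coeff f n))\<^sup>2 + (cmod (hardy_coeff g n))\<^sup>2"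
    unfolding norm_mult complex_mod_cnj by linarith
qed

lemma hardy_inner_sums: "(\<lambda>n. hardy_coeff f n * cnj (hardy_coeff g n)) sums hardy_inner f g"
  unfolding hardy_inner_def by (rule summable_sums[OF hardy_inner_summable])

lemma hardy_inner_self:
  "hardy_inner f f = complex_of_real (SUP r\<in>{0..<1}. mean_sq (hardy_fun f) r)"
proof -
  have "(\<lambda>n. complex_of_real ((cmod (hardy_coeff f n))\<^sup>2)) sums
      complex_of_real (\<Sum>n. (cmod (hardy_coeff f n))\<^sup>2)"
    by (intro sums_of_real summable_sums hardy_coeff_square_summable)
  moreover have "(\<Sum>n. (cmod (hardy_coeff f n))\<^sup>2) = (SUP r\<in>{0..<1}. mean_sq (hardy_fun f) r)"
    using mean_sq_sup(2)[OF hardy_fun_holomorphic, of f] hardy_coeff_square_summable[of f]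
    by (simp add: hardy_coeff_def)
  ultimately show ?thesis
    using hardy_inner_sums[of f f] sums_unique2
    by (auto simp flip: complex_norm_square)
qed

lemma hardy_inner_commute: "hardy_inner g f = cnj (hardy_inner f g)"
proof -
  have "(\<lambda>n. cnj (hardy_coeff f n * cnj (hardy_coeff g n))) sums cnj (hardy_inner f g)"
    by (subst sums_cnj) (rule hardy_inner_sums)
  with hardy_inner_sums[of g f] show ?thesis
    by (auto simp: mult.commute dest: sums_unique2)
qed

lemma hardy_coeff_scale: "hardy_coeff (hardy_scale c f) n = c * hardy_coeff f n"
  unfolding hardy_coeff_def hardy_scale.rep_eq
  by (rule taylor_coeff_cmult[OF hardy_fun_holomorphic])

lemma hardy_inner_scale_left: "hardy_inner (hardy_scale c f) g = c * hardy_inner f g"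
  using sums_mult[OF hardy_inner_sums[of f g], of c] hardy_inner_sums[of "hardy_scale c f" g]
  by (auto simp: hardy_coeff_scale mult.assoc dest: sums_unique2)

instantiation hardy :: real_inner
begin

lift_definition zero_hardy :: hardy is "\<lambda>_. 0"
proof -
  have "mean_sq (\<lambda>_. 0) = (\<lambda>_. 0)" by (simp add: mean_sq_def fun_eq_iff)
  moreover have "bdd_above ((\<lambda>_. 0 :: real) ` {0..<1 :: real})" by (auto intro: bdd_aboveI)
  ultimately show "(\<lambda>_. 0) holomorphic_on ball 0 1 \<and> bdd_above (mean_sq (\<lambda>_. 0) ` {0..<1}) \<and>
    (\<forall>z. z \<notin> ball 0 1 \<longrightarrow> (0::complex) = 0)" by simp
qed

lift_definition plus_hardy :: "hardy \<Rightarrow> hardy \<Rightarrow> hardy" is "\<lambda>f g z. f z + g z"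
proof -
  fix f g :: "complex \<Rightarrow> complex"
  assume f: "f holomorphic_on ball 0 1 \<and> bdd_above (mean_sq f ` {0..<1}) \<and>
    (\<forall>z. z \<notin> ball 0 1 \<longrightarrow> f z = 0)"
  assume g: "g holomorphic_on ball 0 1 \<and> bdd_above (mean_sq g ` {0..<1}) \<and>
    (\<forall>z. z \<notin> ball 0 1 \<longrightarrow> g z = 0)"
  have fh: "f holomorphic_on ball 0 1" and fb: "bdd_above (mean_sq f ` {0..<1})" using f by auto
  have gh: "g holomorphic_on ball 0 1" and gb: "bdd_above (mean_sq g ` {0..<1})" using g by auto
  have h: "(\<lambda>z. f z + g z) holomorphic_on ball 0 1" by (intro holomorphic_intros fh gh)
  have "bdd_above (mean_sq (\<lambda>z. f z + g z) ` {0..<1})"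
    using square_summable_add fb gb
    unfolding mean_sq_sup(1)[OF h] mean_sq_sup(1)[OF fh] mean_sq_sup(1)[OF gh] taylor_coeff_add[OF fh gh]
    by blast
  with f g h show "(\<lambda>z. f z + g z) holomorphic_on ball 0 1 \<and>
    bdd_above (mean_sq (\<lambda>z. f z + g z) ` {0..<1}) \<and> (\<forall>z. z \<notin> ball 0 1 \<longrightarrow> f z + g z = 0)"
    by simp
qed

definition uminus_hardy :: "hardy \<Rightarrow> hardy" where "uminus_hardy f = hardy_scale (- 1) f"

definition minus_hardy :: "hardy \<Rightarrow> hardy \<Rightarrow> hardy" where "minus_hardy f g = f + - g"

definition scaleR_hardy :: "real \<Rightarrow> hardy \<Rightarrow> hardy"
  where "scaleR_hardy c f = hardy_scale (complex_of_real c) f"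

definition inner_hardy :: "hardy \<Rightarrow> hardy \<Rightarrow> real"
  where "inner_hardy f g = Re (hardy_inner f g)"

definition norm_hardy :: "hardy \<Rightarrow> real"
  where "norm_hardy f = sqrt (SUP r\<in>{0..<1}. mean_sq (hardy_fun f) r)"

definition sgn_hardy :: "hardy \<Rightarrow> hardy" where "sgn_hardy f = inverse (norm f) *\<^sub>R f"

definition dist_hardy :: "hardy \<Rightarrow> hardy \<Rightarrow> real" where "dist_hardy f g = norm (f - g)"

definition uniformity_hardy :: "(hardy \<times> hardy) filter"
  where "uniformity_hardy = (INF e\<in>{0<..}. principal {(f, g). dist f g < e})"

definition open_hardy :: "hardy set \<Rightarrow> bool"
  where "open_hardy U \<longleftrightarrow> (\<forall>f\<in>U. \<forall>\<^sub>F (f', g) in uniformity. f' = f \<longrightarrow> g \<in> U)"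

lemma hardy_coeff_add: "hardy_coeff (f + g) n = hardy_coeff f n + hardy_coeff g n"
  unfolding hardy_coeff_def plus_hardy.rep_eq
  by (rule taylor_coeff_add[OF hardy_fun_holomorphic hardy_fun_holomorphic])

lemma hardy_inner_add_left: "hardy_inner (f + g) h = hardy_inner f h + hardy_inner g h"
  using sums_add[OF hardy_inner_sums[of f h] hardy_inner_sums[of g h]] hardy_inner_sums[of "f + g" h]
  by (auto simp: hardy_coeff_add algebra_simps dest: sums_unique2)

instance
proof
  fix f g h :: hardy and a b :: real
  show "f + g + h = f + (g + h)" by transfer (simp add: add.assoc)
  show "f + g = g + f" by transfer (simp add: add.commute)
  show "0 + f = f" by transfer simp
  show "- f + f = 0" unfolding uminus_hardy_def by transfer simp
  show "f - g = f + - g" by (rule minus_hardy_def)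
  show "a *\<^sub>R (f + g) = a *\<^sub>R f + a *\<^sub>R g"
    unfolding scaleR_hardy_def by transfer (simp add: ring_distribs)
  show "(a + b) *\<^sub>R f = a *\<^sub>R f + b *\<^sub>R f"
    unfolding scaleR_hardy_def by transfer (simp add: ring_distribs)
  show "a *\<^sub>R b *\<^sub>R f = (a * b) *\<^sub>R f"
    unfolding scaleR_hardy_def by transfer (simp add: mult.assoc)
  show "1 *\<^sub>R f = f" unfolding scaleR_hardy_def by transfer simp
  show "sgn f = inverse (norm f) *\<^sub>R f" by (rule sgn_hardy_def)
  show "dist f g = norm (f - g)" by (rule dist_hardy_def)
  show "uniformity = (INF e\<in>{0<..}. principal {(x :: hardy, y). dist x y < e})"
    by (rule uniformity_hardy_def)
  show "open U \<longleftrightarrow> (\<forall>x\<in>U. \<forall>\<^sub>F (x', y) in uniformity. x' = x \<longrightarrow> y \<in> U)" for U :: "hardy set"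
    by (rule open_hardy_def)
  show "inner f g = inner g f"
    unfolding inner_hardy_def using hardy_inner_commute[of f g] by simp
  show "inner (f + g) h = inner f h + inner g h"
    by (simp add: inner_hardy_def hardy_inner_add_left)
  show "inner (a *\<^sub>R f) g = a * inner f g"
    by (simp add: inner_hardy_def scaleR_hardy_def hardy_inner_scale_left)
  have self: "inner f f = (\<Sum>n. (cmod (hardy_coeff f n))\<^sup>2)"
    unfolding inner_hardy_def hardy_inner_self
    using mean_sq_sup(2)[OF hardy_fun_holomorphic, of f] hardy_coeff_square_summable[of f]
    by (simp add: hardy_coeff_def)
  show "0 \<le> inner f f"
    unfolding self by (intro suminf_nonneg hardy_coeff_square_summable) auto
  show "inner f f = 0 \<longleftrightarrow> f = 0"
  proof
    assume "inner f f = 0"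
    hence "hardy_coeff f n = 0" for n
      using suminf_eq_zero_iff[OF hardy_coeff_square_summable[of f]] unfolding self by auto
    hence "hardy_fun f z = 0" if "z \<in> ball 0 1" for z
      using hardy_coeff_sums[OF that, of f] by (simp add: sums_iff)
    thus "f = 0" by (intro hardy_eqI) (simp add: zero_hardy.rep_eq)
  next
    assume "f = 0"
    moreover have "mean_sq (\<lambda>_. 0) = (\<lambda>_. 0)" by (simp add: mean_sq_def fun_eq_iff)
    ultimately show "inner f f = 0"
      by (simp add: inner_hardy_def hardy_inner_self zero_hardy.rep_eq)
  qed
  show "norm f = sqrt (inner f f)"
    by (simp add: norm_hardy_def inner_hardy_def hardy_inner_self)
qed

end


section \<open>Orthogonal projections, inner functions and cross sections\<close>

text \<open>The norm of \<^typ>\<open>hardy \<Rightarrow>\<^sub>L hardy\<close> is the operator norm. Its elements are only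
  real-linear, hence the explicit condition of complex homogeneity.\<close>

definition orthogonal_projection :: "(hardy \<Rightarrow>\<^sub>L hardy) \<Rightarrow> bool"
  where "orthogonal_projection p \<longleftrightarrow>
    (\<forall>c f. blinfun_apply p (hardy_scale c f) = hardy_scale c (blinfun_apply p f)) \<and>
    p o\<^sub>L p = p \<and>
    (\<forall>f g. hardy_inner (blinfun_apply p f) g = hardy_inner f (blinfun_apply p g))"

definition nontrivial_projection :: "(hardy \<Rightarrow>\<^sub>L hardy) \<Rightarrow> bool"
  where "nontrivial_projection p \<longleftrightarrow> orthogonal_projection p \<and> p \<noteq> 0 \<and> p \<noteq> id_blinfun"

definition inner_function :: "(complex \<Rightarrow> complex) \<Rightarrow> bool"
  where "inner_function \<phi> \<longleftrightarrow>
    \<phi> holomorphic_on ball 0 1 \<and> bounded (\<phi> ` ball 0 1) \<and>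
    (AE t in lebesgue_on {0..2 * pi}.
      \<exists>l. ((\<lambda>r. \<phi> (complex_of_real r * cis t)) \<longlongrightarrow> l) (at_left 1) \<and> cmod l = 1)"

text \<open>The set \<open>\<phi> H\<^sup>2\<close>. For bounded holomorphic \<open>\<phi>\<close> every product \<open>\<phi> g\<close> lies in the Hardy space.\<close>

definition mult_hardy :: "(complex \<Rightarrow> complex) \<Rightarrow> hardy set"
  where "mult_hardy \<phi> = {f. \<exists>g. \<forall>z\<in>ball 0 1. hardy_fun f z = \<phi> z * hardy_fun g z}"

definition hinf_norm :: "(complex \<Rightarrow> complex) \<Rightarrow> real"
  where "hinf_norm \<phi> = (SUP z\<in>ball 0 1. cmod (\<phi> z))"

definition hinf_continuous_on :: "real set \<Rightarrow> (real \<Rightarrow> complex \<Rightarrow> complex) \<Rightarrow> bool"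
  where "hinf_continuous_on T \<phi> \<longleftrightarrow>
    (\<forall>t\<in>T. ((\<lambda>s. hinf_norm (\<lambda>z. \<phi> s z - \<phi> t z)) \<longlongrightarrow> 0) (at t within T))"

definition cross_section :: "(real \<Rightarrow> hardy \<Rightarrow>\<^sub>L hardy) \<Rightarrow> (real \<Rightarrow> complex \<Rightarrow> complex) \<Rightarrow> bool"
  where "cross_section p \<phi> \<longleftrightarrow>
    (\<forall>t\<in>{0..1}. inner_function (\<phi> t) \<and> range (blinfun_apply (p t)) = mult_hardy (\<phi> t))"

end

theory Submission
  imports Defs
begin

text \<open>
  The path is \<open>t \<mapsto>\<close> the projection onto \<open>\<phi>\<^sub>a H\<^sup>2\<close> with \<open>a = t / 2\<close>, where \<open>\<phi>\<^sub>a\<close> is a Blaschke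
  product. In the coordinate \<open>\<zeta> = (1 - z) / (1 + z)\<close>, which maps the disc to the right half-plane and
  \<open>1\<close> to \<open>0\<close>, its zeros are \<open>c\<^sub>k = 2\<^sup>-\<^sup>k cis a\<close> for \<open>k = 0, 1, 2, \<dots>\<close>. Changing \<open>a\<close> moves every zero by
  the same small hyperbolic distance, roughly parallel to the boundary, and the zeros lie at all
  dyadic scales near \<open>z = 1\<close>.

  Why the projections are close. On the unit circle the \<open>k\<close>-th factor of \<open>\<phi>\<^sub>s\<close> is the \<open>k\<close>-th factor of
  \<open>\<phi>\<^sub>a\<close> multiplied by \<open>q\<^sup>2 / \<bar>q\<bar>\<^sup>2\<close>, where \<open>q = (\<zeta> + cnj c\<^sub>k(a)) / (\<zeta> + cnj c\<^sub>k(s))\<close> is holomorphic and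
  free of zeros in the disc. The errors \<open>\<bar>\<bar>q\<bar>\<^sup>2 - 1\<bar>\<close> decay geometrically away from the scale \<open>2\<^sup>-\<^sup>k\<close>,
  so that their sum over all \<open>k\<close> is at most \<open>14 \<bar>a - s\<bar>\<close>, uniformly on the circle. Therefore the
  bounded function \<open>h = \<Prod> q\<^sup>2\<close> satisfies \<open>\<bar>\<phi>\<^sub>s - \<phi>\<^sub>a h\<bar> \<le> exp (14 \<bar>a - s\<bar>) - 1\<close>
  (\<open>blaschke_approx\<close>). So a unit vector of \<open>\<phi>\<^sub>s H\<^sup>2\<close> is close to \<open>\<phi>\<^sub>a H\<^sup>2\<close>, and conversely, and this
  bounds the distance of the two projections (\<open>range_proj_blaschke_dist\<close>).

  Why the inner functions are far apart. The phases of \<open>q\<^sup>2\<close>, unlike the logarithms of the moduli, do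
  not decay as \<open>\<zeta>\<close> tends to \<open>0\<close>: each factor with \<open>2\<^sup>-\<^sup>k\<close> much larger than \<open>\<bar>\<zeta>\<bar>\<close>
  contributes about \<open>2 (s - a)\<close> to the phase of \<open>\<phi>\<^sub>s / \<phi>\<^sub>a\<close>. So along the points of the circle with
  \<open>\<zeta> = \<i> 2\<^sup>-\<^sup>n\<close> this quotient keeps turning, by an angle tending to \<open>2 (s - a)\<close> at each step. For
  \<open>a = 0\<close> and \<open>s = pi / (2 m)\<close> it is nearly reversed after \<open>m\<close> steps when \<open>n\<close> is large, and hence no unimodular multiples of
  \<open>\<phi>\<^sub>s\<close> and \<open>\<phi>\<^sub>0\<close> have distance below \<open>1\<close> in the supremum norm (\<open>blaschke_far\<close>). An inner function is
  determined by its range up to a unimodular constant (\<open>inner_function_unique\<close>), so a cross section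
  of the path is discontinuous at \<open>t = 0\<close>.

  The projection onto \<open>\<phi> H\<^sup>2\<close> is \<open>M M\<^sup>*\<close>, where \<open>M\<close> is multiplication by \<open>\<phi>\<close>. It exists because \<open>M\<close> is
  isometric (\<open>norm_hardy_mult\<close>).
\<close>

section \<open>The Hardy space as a space of coefficient sequences\<close>

lemma mean_sq_cong:
  assumes "\<And>z. z \<in> ball 0 1 \<Longrightarrow> f z = g z" "r \<in> {0..<1}"
  shows "mean_sq f r = mean_sq g r"
proof -
  have "f (of_real r * cis t) = g (of_real r * cis t)" for t
    using assms by (intro assms(1)) (simp add: norm_mult)
  thus ?thesis by (simp add: mean_sq_def)
qed

definition to_hardy :: "(complex \<Rightarrow> complex) \<Rightarrow> hardy"
  where "to_hardy f = Abs_hardy (\<lambda>z. if z \<in> ball 0 1 then f z else 0)"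

lemma hardy_fun_to_hardy:
  assumes "f holomorphic_on ball 0 1" "bdd_above (mean_sq f ` {0..<1})" "z \<in> ball 0 1"
  shows "hardy_fun (to_hardy f) z = f z"
proof -
  let ?g = "\<lambda>z. if z \<in> ball 0 1 then f z else 0"
  have "?g holomorphic_on ball 0 1" using assms(1) by (rule holomorphic_transform) auto
  moreover have "mean_sq ?g ` {0..<1} = mean_sq f ` {0..<1}"
    by (intro image_cong mean_sq_cong) auto
  ultimately have "?g \<in> {f. f holomorphic_on ball 0 1 \<and> bdd_above (mean_sq f ` {0..<1}) \<and>
      (\<forall>z. z \<notin> ball 0 1 \<longrightarrow> f z = 0)}" using assms(2) by auto
  from Abs_hardy_inverse[OF this] show ?thesis using assms(3) by (simp add: to_hardy_def)
qed

lemma hardy_fun_scale: "hardy_fun (hardy_scale c f) z = c * hardy_fun f z"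
  by (simp add: hardy_scale.rep_eq)
lemma hardy_fun_add: "hardy_fun (f + g) z = hardy_fun f z + hardy_fun g z"
  by (simp add: plus_hardy.rep_eq)
lemma hardy_fun_diff: "hardy_fun (f - g) z = hardy_fun f z - hardy_fun g z"
  by (simp add: minus_hardy_def uminus_hardy_def plus_hardy.rep_eq hardy_scale.rep_eq)
lemma hardy_fun_zero: "hardy_fun 0 z = 0"
  by (simp add: zero_hardy.rep_eq)

lemma bdd_above_mean_sq: "bdd_above (mean_sq (hardy_fun f) ` {0..<1})"
  using hardy_fun[of f] by simp

lemma norm_hardy_sq: "(norm f)\<^sup>2 = (SUP r\<in>{0..<1}. mean_sq (hardy_fun f) r)"
proof -
  have "mean_sq (hardy_fun f) 0 \<le> (SUP r\<in>{0..<1}. mean_sq (hardy_fun f) r)"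
    by (rule cSUP_upper[OF _ bdd_above_mean_sq]) simp
  moreover have "0 \<le> mean_sq (hardy_fun f) 0" by (rule mean_sq_nonneg[OF hardy_fun_holomorphic]) auto
  ultimately show ?thesis unfolding norm_hardy_def by simp
qed

lemma norm_hardy_sums: "(\<lambda>n. (cmod (hardy_coeff f n))\<^sup>2) sums (norm f)\<^sup>2"
  unfolding norm_hardy_sq hardy_coeff_def
  using mean_sq_sup[OF hardy_fun_holomorphic, of f] bdd_above_mean_sq[of f] by (simp add: summable_sums)

lemma mean_sq_le_norm: "r \<in> {0..<1} \<Longrightarrow> mean_sq (hardy_fun f) r \<le> (norm f)\<^sup>2"
  unfolding norm_hardy_sq by (rule cSUP_upper[OF _ bdd_above_mean_sq])

lemma norm_hardy_le:
  assumes "\<And>r. r \<in> {0..<1} \<Longrightarrow> mean_sq (hardy_fun f) r \<le> C\<^sup>2" "0 \<le> C"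
  shows "norm f \<le> C"
proof (rule power2_le_imp_le)
  show "(norm f)\<^sup>2 \<le> C\<^sup>2" unfolding norm_hardy_sq using assms(1) by (intro cSUP_least) auto
qed fact

text \<open>The square means increase with the radius, so their supremum is their limit.\<close>

lemma mean_sq_tendsto_norm:
  assumes r: "r \<longlonglongrightarrow> 1" "\<And>n. r n \<in> {0..<1}"
  shows "(\<lambda>n. mean_sq (hardy_fun f) (r n)) \<longlonglongrightarrow> (norm f)\<^sup>2"
proof (rule tendstoI)
  fix e :: real assume e: "e > 0"
  have "\<exists>s\<in>{0..<1}. (norm f)\<^sup>2 - e < mean_sq (hardy_fun f) s"
    using less_cSUP_iff[OF _ bdd_above_mean_sq, of "(norm f)\<^sup>2 - e" f] e unfolding norm_hardy_sq by auto
  then obtain s where s: "s \<in> {0..<1}" "(norm f)\<^sup>2 - e < mean_sq (hardy_fun f) s" by blast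
  have mono: "mean_sq (hardy_fun f) s \<le> mean_sq (hardy_fun f) t" if "s \<le> t" "t < 1" for t
    by (rule sums_le[OF _ mean_sq_sums mean_sq_sums])
      (use s that in \<open>auto intro!: hardy_fun_holomorphic mult_left_mono power_mono\<close>)
  have "eventually (\<lambda>n. s < r n) sequentially"
    using order_tendstoD(1)[OF r(1), of s] s by auto
  thus "eventually (\<lambda>n. dist (mean_sq (hardy_fun f) (r n)) ((norm f)\<^sup>2) < e) sequentially"
  proof eventually_elim
    case (elim n)
    with mono[of "r n"] mean_sq_le_norm[OF r(2), of f n] s r(2)[of n] show ?case
      by (auto simp: dist_real_def)
  qed
qed

lemma hardy_coeff_diff: "hardy_coeff (f - g) n = hardy_coeff f n - hardy_coeff g n"
  by (simp add: minus_hardy_def uminus_hardy_def hardy_coeff_add hardy_coeff_scale)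

lemma hardy_eq_coeffI:
  assumes "\<And>n. hardy_coeff f n = hardy_coeff g n"
  shows "f = g"
proof (rule hardy_eqI)
  fix z :: complex assume z: "z \<in> ball 0 1"
  show "hardy_fun f z = hardy_fun g z"
    using hardy_coeff_sums[OF z, of f] hardy_coeff_sums[OF z, of g] sums_unique2 unfolding assms by blast
qed

text \<open>Riesz--Fischer for the Hardy space: it replaces an appeal to completeness in the construction of
  adjoints.\<close>

lemma hardy_from_coeffs:
  assumes "summable (\<lambda>n. (cmod (a n))\<^sup>2)"
  obtains f where "\<And>n. hardy_coeff f n = a n"
proof -
  define g where "g z = (\<Sum>n. a n * z ^ n)" for z
  have "(\<lambda>n. (cmod (a n))\<^sup>2) \<longlonglongrightarrow> 0" by (rule summable_LIMSEQ_zero[OF assms])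
  hence "(\<lambda>n. sqrt ((cmod (a n))\<^sup>2)) \<longlonglongrightarrow> sqrt 0" by (intro tendsto_intros)
  hence "Bseq (\<lambda>n. cmod (a n))" by (intro convergent_imp_Bseq convergentI) simp
  then obtain K where K: "\<And>n. cmod (a n) \<le> K" by (auto simp: Bseq_def)
  have sums: "(\<lambda>n. a n * z ^ n) sums g z" if "z \<in> ball 0 1" for z
    unfolding g_def
  proof (rule summable_sums, rule summable_comparison_test')
    show "summable (\<lambda>n. K * cmod z ^ n)" using that by (intro summable_mult summable_geometric) auto
    show "norm (a n * z ^ n) \<le> K * cmod z ^ n" for n
      by (simp add: norm_mult norm_power mult_right_mono K)
  qed
  have hol: "g holomorphic_on ball 0 1"
    by (rule power_series_holomorphic[where a = a]) (use sums in simp)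
  have coeff: "taylor_coeff g n = a n" for n
  proof (rule ccontr)
    assume n: "taylor_coeff g n \<noteq> a n"
    define b where "b n = taylor_coeff g n - a n" for n
    have b: "(\<lambda>n. b n * (z - 0) ^ n) sums 0" if "norm (z - 0) < 1" for z
      using sums_diff[OF taylor_coeff_sums[OF hol] sums, of z z] that
      by (simp add: b_def algebra_simps)
    have "b 0 = 0" using b[of 0] powser_sums_zero[of b] sums_unique2 by fastforce
    hence "n > 0" using n by (cases n) (auto simp: b_def)
    moreover have "b n \<noteq> 0" using n by (simp add: b_def)
    ultimately obtain s where s: "0 < s" "\<And>z. z \<in> cball 0 s - {0 :: complex} \<Longrightarrow> (0::complex) \<noteq> 0"
      using powser_0_nonzero[where r = 1 and a = b and \<xi> = 0 and f = "\<lambda>_. 0" and m = n, OF _ b]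
      by (metis zero_less_one)
    \<comment> \<open>A power series with sum \<open>0\<close> and a nonzero coefficient would have isolated zeros.\<close>
    have "of_real s \<in> cball 0 s - {0 :: complex}" using s by simp
    from s(2)[OF this] show False by simp
  qed
  have bdd: "bdd_above (mean_sq g ` {0..<1})"
    using mean_sq_sup(1)[OF hol] assms by (simp add: coeff)
  have "hardy_coeff (to_hardy g) n = a n" for n
  proof -
    have "(deriv ^^ n) (hardy_fun (to_hardy g)) 0 = (deriv ^^ n) g 0"
      by (rule higher_deriv_transform_within_open[where S = "ball 0 1"])
        (auto intro!: hardy_fun_holomorphic hol hardy_fun_to_hardy bdd)
    thus ?thesis unfolding hardy_coeff_def taylor_coeff_def using coeff[of n, unfolded taylor_coeff_def] by simp
  qed
  thus ?thesis using that by blast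
qed

text \<open>The argument is meant to be bounded and holomorphic on the disc; only then is the product known to
  lie in the Hardy space.\<close>

definition hardy_mult :: "(complex \<Rightarrow> complex) \<Rightarrow> hardy \<Rightarrow> hardy"
  where "hardy_mult u f = to_hardy (\<lambda>z. u z * hardy_fun f z)"

lemma continuous_on_circle:
  assumes "f holomorphic_on ball 0 1" "r \<in> {0..<1}"
  shows "continuous_on A (\<lambda>t. f (complex_of_real r * cis t))"
proof (rule continuous_on_compose2[OF holomorphic_on_imp_continuous_on[OF assms(1)]])
  show "continuous_on A (\<lambda>t. complex_of_real r * cis t)"
    unfolding cis_conv_exp by (intro continuous_intros)
qed (use assms(2) in \<open>auto simp: norm_mult\<close>)

lemma mean_sq_mult_le:
  assumes u: "u holomorphic_on ball 0 1" "\<And>z. z \<in> ball 0 1 \<Longrightarrow> cmod (u z) \<le> C"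
    and f: "f holomorphic_on ball 0 1" and r: "r \<in> {0..<1}"
  shows "mean_sq (\<lambda>z. u z * f z) r \<le> C\<^sup>2 * mean_sq f r"
proof -
  have "integral {0..2 * pi} (\<lambda>t. (cmod (u (of_real r * cis t) * f (of_real r * cis t)))\<^sup>2)
      \<le> integral {0..2 * pi} (\<lambda>t. C\<^sup>2 * (cmod (f (of_real r * cis t)))\<^sup>2)"
  proof (rule integral_le)
    show "(\<lambda>t. (cmod (u (of_real r * cis t) * f (of_real r * cis t)))\<^sup>2) integrable_on {0..2 * pi}"
      "(\<lambda>t. C\<^sup>2 * (cmod (f (of_real r * cis t)))\<^sup>2) integrable_on {0..2 * pi}"
      by (intro integrable_continuous_real continuous_intros continuous_on_circle u f r)+
    fix t
    have "cmod (u (of_real r * cis t)) \<le> C" using r by (intro u(2)) (auto simp: norm_mult)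
    thus "(cmod (u (of_real r * cis t) * f (of_real r * cis t)))\<^sup>2 \<le> C\<^sup>2 * (cmod (f (of_real r * cis t)))\<^sup>2"
      unfolding norm_mult power_mult_distrib by (intro mult_right_mono power_mono) auto
  qed
  thus ?thesis by (simp add: mean_sq_def divide_right_mono)
qed

lemma
  assumes u: "u holomorphic_on ball 0 1" "\<And>z. z \<in> ball 0 1 \<Longrightarrow> cmod (u z) \<le> C"
  shows hardy_fun_mult_bound: "z \<in> ball 0 1 \<Longrightarrow> hardy_fun (hardy_mult u f) z = u z * hardy_fun f z"
    and norm_hardy_mult_le: "norm (hardy_mult u f) \<le> C * norm f"
proof -
  have C: "0 \<le> C" using order_trans[OF norm_ge_zero u(2)[of 0]] by simp
  have le: "mean_sq (\<lambda>z. u z * hardy_fun f z) r \<le> (C * norm f)\<^sup>2" if "r \<in> {0..<1}" for r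
  proof -
    have "mean_sq (\<lambda>z. u z * hardy_fun f z) r \<le> C\<^sup>2 * mean_sq (hardy_fun f) r"
      by (rule mean_sq_mult_le[OF u hardy_fun_holomorphic that])
    also have "\<dots> \<le> C\<^sup>2 * (norm f)\<^sup>2" using mean_sq_le_norm[OF that] by (intro mult_left_mono) auto
    finally show ?thesis by (simp add: power_mult_distrib)
  qed
  show eq: "hardy_fun (hardy_mult u f) z = u z * hardy_fun f z" if "z \<in> ball 0 1" for z
    unfolding hardy_mult_def
    by (rule hardy_fun_to_hardy[OF _ _ that]) (auto intro!: holomorphic_intros u hardy_fun_holomorphic bdd_aboveI le)
  show "norm (hardy_mult u f) \<le> C * norm f"
  proof (rule norm_hardy_le)
    fix r :: real assume r: "r \<in> {0..<1}"
    show "mean_sq (hardy_fun (hardy_mult u f)) r \<le> (C * norm f)\<^sup>2"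
      using le[OF r] mean_sq_cong[OF eq r] by simp
  qed (use C in simp)
qed

definition bounded_holomorphic :: "(complex \<Rightarrow> complex) \<Rightarrow> bool"
  where "bounded_holomorphic u \<longleftrightarrow> u holomorphic_on ball 0 1 \<and> bounded (u ` ball 0 1)"

lemma bounded_holomorphicE:
  assumes "bounded_holomorphic u"
  obtains C where "u holomorphic_on ball 0 1" "\<And>z. z \<in> ball 0 1 \<Longrightarrow> cmod (u z) \<le> C"
proof -
  from assms obtain C where "u holomorphic_on ball 0 1" "\<forall>x\<in>u ` ball 0 1. cmod x \<le> C"
    unfolding bounded_holomorphic_def bounded_iff by blast
  thus thesis using that[of C] by simp
qed

lemma inner_bounded_holomorphic: "inner_function \<phi> \<Longrightarrow> bounded_holomorphic \<phi>"
  by (simp add: inner_function_def bounded_holomorphic_def)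

lemma hardy_fun_mult:
  assumes "bounded_holomorphic u" "z \<in> ball 0 1"
  shows "hardy_fun (hardy_mult u f) z = u z * hardy_fun f z"
  using assms by (elim bounded_holomorphicE) (rule hardy_fun_mult_bound)

lemma hardy_mult_add: "bounded_holomorphic u \<Longrightarrow> hardy_mult u (f + g) = hardy_mult u f + hardy_mult u g"
  and hardy_mult_scale: "bounded_holomorphic u \<Longrightarrow> hardy_mult u (hardy_scale c f) = hardy_scale c (hardy_mult u f)"
  and hardy_mult_mult_z: "bounded_holomorphic u \<Longrightarrow> hardy_mult u (mult_z f) = mult_z (hardy_mult u f)"
  by (intro hardy_eqI; simp add: hardy_fun_mult hardy_fun_add hardy_fun_scale mult_z.rep_eq algebra_simps)+

lemma bounded_linear_hardy_mult:
  assumes "bounded_holomorphic u"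
  shows "bounded_linear (hardy_mult u)"
proof -
  from assms obtain C where C: "u holomorphic_on ball 0 1" "\<And>z. z \<in> ball 0 1 \<Longrightarrow> cmod (u z) \<le> C"
    using bounded_holomorphicE by blast
  show ?thesis
  proof (rule bounded_linear_intro)
    show "norm (hardy_mult u f) \<le> norm f * C" for f
      using norm_hardy_mult_le[OF C, of f] by (simp add: mult.commute)
  qed (simp_all add: hardy_mult_add hardy_mult_scale scaleR_hardy_def assms)
qed

definition hardy_of_coeffs :: "(nat \<Rightarrow> complex) \<Rightarrow> hardy"
  where "hardy_of_coeffs a = (THE f. \<forall>n. hardy_coeff f n = a n)"

lemma hardy_coeff_of_coeffs:
  assumes "summable (\<lambda>n. (cmod (a n))\<^sup>2)"
  shows "hardy_coeff (hardy_of_coeffs a) n = a n"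
proof -
  obtain f where f: "\<And>n. hardy_coeff f n = a n" using hardy_from_coeffs[OF assms] by blast
  have "hardy_of_coeffs a = f"
    unfolding hardy_of_coeffs_def by (rule the_equality) (auto intro: hardy_eq_coeffI simp: f)
  thus ?thesis using f by simp
qed

definition hardy_poly :: "(nat \<Rightarrow> complex) \<Rightarrow> nat \<Rightarrow> hardy"
  where "hardy_poly a N = hardy_of_coeffs (\<lambda>n. if n < N then a n else 0)"

definition hardy_monom :: "nat \<Rightarrow> hardy"
  where "hardy_monom n = hardy_of_coeffs (\<lambda>k. if k = n then 1 else 0)"

lemma hardy_coeff_poly: "hardy_coeff (hardy_poly a N) n = (if n < N then a n else 0)"
  unfolding hardy_poly_def
  by (rule hardy_coeff_of_coeffs, rule summable_finite[of "{..<N}"]) auto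

lemma hardy_coeff_monom: "hardy_coeff (hardy_monom n) k = (if k = n then 1 else 0)"
  unfolding hardy_monom_def
  by (rule hardy_coeff_of_coeffs, rule summable_finite[of "{n}"]) auto

lemma hardy_coeff_zero: "hardy_coeff 0 n = 0"
proof -
  have "hardy_scale 0 0 = 0" by (intro hardy_eqI) (simp add: hardy_fun_scale hardy_fun_zero)
  thus ?thesis using hardy_coeff_scale[of 0 0 n] by simp
qed

lemma hardy_poly_0: "hardy_poly a 0 = 0"
  by (intro hardy_eq_coeffI) (simp add: hardy_coeff_poly hardy_coeff_zero)

lemma hardy_poly_Suc: "hardy_poly a (Suc N) = hardy_poly a N + hardy_scale (a N) (hardy_monom N)"
  by (intro hardy_eq_coeffI) (auto simp: hardy_coeff_poly hardy_coeff_add hardy_coeff_scale hardy_coeff_monom less_Suc_eq)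

lemma hardy_fun_poly:
  assumes "z \<in> ball 0 1"
  shows "hardy_fun (hardy_poly a N) z = (\<Sum>n<N. a n * z ^ n)"
proof -
  have "(\<lambda>n. hardy_coeff (hardy_poly a N) n * z ^ n) sums (\<Sum>n<N. hardy_coeff (hardy_poly a N) n * z ^ n)"
    by (rule sums_finite) (auto simp: hardy_coeff_poly)
  from sums_unique2[OF hardy_coeff_sums[OF assms] this] show ?thesis by (simp add: hardy_coeff_poly)
qed

lemma norm_hardy_poly: "(norm (hardy_poly a N))\<^sup>2 = (\<Sum>n<N. (cmod (a n))\<^sup>2)"
proof -
  have "(\<lambda>n. (cmod (hardy_coeff (hardy_poly a N) n))\<^sup>2) sums (\<Sum>n<N. (cmod (hardy_coeff (hardy_poly a N) n))\<^sup>2)"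
    by (rule sums_finite) (auto simp: hardy_coeff_poly)
  from sums_unique2[OF norm_hardy_sums this] show ?thesis by (simp add: hardy_coeff_poly)
qed

text \<open>Density of the polynomials: the squared distance is the tail of the convergent series of
  squared coefficients.\<close>

lemma hardy_poly_tendsto: "(\<lambda>N. hardy_poly (hardy_coeff f) N) \<longlonglongrightarrow> f"
proof -
  let ?p = "hardy_poly (hardy_coeff f)" and ?S = "\<lambda>N. \<Sum>n<N. (cmod (hardy_coeff f n))\<^sup>2"
  have "(norm (?p N - f))\<^sup>2 = (norm f)\<^sup>2 - ?S N" for N
  proof -
    have "(\<lambda>n. (cmod (hardy_coeff f n))\<^sup>2 - (cmod (hardy_coeff (?p N) n))\<^sup>2) sums ((norm f)\<^sup>2 - (norm (?p N))\<^sup>2)"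
      by (intro sums_diff norm_hardy_sums)
    also have "(\<lambda>n. (cmod (hardy_coeff f n))\<^sup>2 - (cmod (hardy_coeff (?p N) n))\<^sup>2)
        = (\<lambda>n. (cmod (hardy_coeff (?p N - f) n))\<^sup>2)"
      by (auto simp: hardy_coeff_diff hardy_coeff_poly)
    finally have "(norm (?p N - f))\<^sup>2 = (norm f)\<^sup>2 - (norm (?p N))\<^sup>2"
      by (rule sums_unique2[OF norm_hardy_sums])
    thus ?thesis unfolding norm_hardy_poly .
  qed
  moreover have "(\<lambda>N. (norm f)\<^sup>2 - ?S N) \<longlonglongrightarrow> (norm f)\<^sup>2 - (norm f)\<^sup>2"
    using norm_hardy_sums[of f] by (intro tendsto_intros) (simp add: sums_def)
  ultimately have "(\<lambda>N. (norm (?p N - f))\<^sup>2) \<longlonglongrightarrow> 0" by simp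
  hence "(\<lambda>N. sqrt ((norm (?p N - f))\<^sup>2)) \<longlonglongrightarrow> sqrt 0" by (intro tendsto_intros)
  hence "(\<lambda>N. norm (?p N - f)) \<longlonglongrightarrow> 0" by simp
  thus ?thesis by (simp add: tendsto_norm_zero_iff LIM_zero_iff)
qed

lemma hardy_fun_monom: "z \<in> ball 0 1 \<Longrightarrow> hardy_fun (hardy_monom n) z = z ^ n"
proof -
  assume z: "z \<in> ball 0 1"
  have "(\<lambda>k. hardy_coeff (hardy_monom n) k * z ^ k) sums (\<Sum>k\<in>{n}. hardy_coeff (hardy_monom n) k * z ^ k)"
    by (rule sums_finite) (auto simp: hardy_coeff_monom)
  from sums_unique2[OF hardy_coeff_sums[OF z] this] show ?thesis by (simp add: hardy_coeff_monom)
qed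

lemma hardy_monom_Suc: "hardy_monom (Suc n) = mult_z (hardy_monom n)"
  by (rule hardy_eqI) (simp add: hardy_fun_monom mult_z.rep_eq)

lemma hardy_coeff_mult_z_0: "hardy_coeff (mult_z f) 0 = 0"
  by (simp add: hardy_coeff_def taylor_coeff_def mult_z.rep_eq)

lemma norm_hardy_monom: "norm (hardy_monom n) = 1"
proof -
  have "(\<lambda>k. (cmod (hardy_coeff (hardy_monom n) k))\<^sup>2) sums (\<Sum>k\<in>{n}. (cmod (hardy_coeff (hardy_monom n) k))\<^sup>2)"
    by (rule sums_finite) (auto simp: hardy_coeff_monom)
  from sums_unique2[OF norm_hardy_sums this] have "(norm (hardy_monom n))\<^sup>2 = 1\<^sup>2" by (simp add: hardy_coeff_monom)
  thus ?thesis by (simp only: power2_eq_iff_nonneg norm_ge_zero zero_le_one)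
qed

section \<open>Multiplication by an inner function is isometric\<close>

lemma radii_to_one:
  obtains r :: "nat \<Rightarrow> real" where "r \<longlonglongrightarrow> 1" "\<And>n. r n \<in> {0..<1}"
proof
  show "(\<lambda>n. 1 - 1 / real (n + 1)) \<longlonglongrightarrow> 1"
    using tendsto_diff[OF tendsto_const[of 1] LIMSEQ_inverse_real_of_nat] by (simp add: field_simps)
  show "1 - 1 / real (n + 1) \<in> {0..<1}" for n by auto
qed

text \<open>Dominated convergence along the radii. The limit does not involve \<open>\<phi>\<close>, which is unimodular almost
  everywhere on the circle; comparing with \<open>\<phi> = 1\<close> yields the isometry for polynomials.\<close>

lemma inner_mean_sq_tendsto:
  assumes \<phi>: "inner_function \<phi>" and F: "continuous_on (cball 0 1) F" "F holomorphic_on ball 0 1"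
    and r: "r \<longlonglongrightarrow> 1" "\<And>n. r n \<in> {0..<1}"
  shows "(\<lambda>n. mean_sq (\<lambda>z. \<phi> z * F z) (r n)) \<longlonglongrightarrow>
    1 / (2 * pi) * (LINT t|lebesgue_on {0..2 * pi}. (cmod (F (cis t)))\<^sup>2)"
proof -
  define s where "s n t = (cmod (\<phi> (of_real (r n) * cis t) * F (of_real (r n) * cis t)))\<^sup>2" for n t
  obtain C where C: "\<phi> holomorphic_on ball 0 1" "\<And>z. z \<in> ball 0 1 \<Longrightarrow> cmod (\<phi> z) \<le> C"
    using bounded_holomorphicE[OF inner_bounded_holomorphic[OF \<phi>]] by blast
  have "compact (F ` cball 0 1)" by (intro compact_continuous_image F) auto
  hence "bounded (F ` cball 0 1)" by (rule compact_imp_bounded)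
  then obtain K where "\<forall>x\<in>F ` cball 0 1. cmod x \<le> K" unfolding bounded_iff by blast
  hence K: "cmod (F z) \<le> K" if "z \<in> cball 0 1" for z using that by blast
  have contF: "continuous_on A (\<lambda>t. F (cis t))" for A
  proof (rule continuous_on_compose2[OF F(1)])
    show "continuous_on A cis" unfolding cis_conv_exp by (intro continuous_intros)
  qed auto
  have cs: "continuous_on {0..2 * pi} (s n)" for n
    unfolding s_def by (intro continuous_intros continuous_on_circle C F r)
  have int: "mean_sq (\<lambda>z. \<phi> z * F z) (r n) = 1 / (2 * pi) * (LINT t|lebesgue_on {0..2 * pi}. s n t)" for n
    unfolding mean_sq_def s_def[symmetric]
    by (subst lebesgue_integral_eq_integral) (auto intro: continuous_imp_integrable_real cs)
  have fl: "filterlim r (at_left 1) sequentially"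
    unfolding filterlim_at using r by (auto simp: less_le)
  have "(\<lambda>n. LINT t|lebesgue_on {0..2 * pi}. s n t) \<longlonglongrightarrow> (LINT t|lebesgue_on {0..2 * pi}. (cmod (F (cis t)))\<^sup>2)"
  proof (rule integral_dominated_convergence[where w = "\<lambda>_. (C * K)\<^sup>2"])
    show "(\<lambda>t. (cmod (F (cis t)))\<^sup>2) \<in> borel_measurable (lebesgue_on {0..2 * pi})"
      by (intro continuous_imp_measurable_on_sets_lebesgue continuous_intros contF) auto
    show "s n \<in> borel_measurable (lebesgue_on {0..2 * pi})" for n
      by (intro continuous_imp_measurable_on_sets_lebesgue cs) auto
    show "integrable (lebesgue_on {0..2 * pi}) (\<lambda>_. (C * K)\<^sup>2)"
      by (intro continuous_imp_integrable_real continuous_intros)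
    show "AE t in lebesgue_on {0..2 * pi}. norm (s n t) \<le> (C * K)\<^sup>2" for n
    proof (rule AE_I2)
      fix t
      have b: "of_real (r n) * cis t \<in> ball 0 1" using r(2)[of n] by (simp add: norm_mult)
      hence "cmod (\<phi> (of_real (r n) * cis t) * F (of_real (r n) * cis t)) \<le> C * K"
        unfolding norm_mult using C(2)[OF b] K[of "of_real (r n) * cis t"] C(2)[of 0]
        by (intro mult_mono) (auto intro: order_trans[OF norm_ge_zero])
      thus "norm (s n t) \<le> (C * K)\<^sup>2" unfolding s_def by (simp add: power_mono)
    qed
    have "AE t in lebesgue_on {0..2 * pi}.
        \<exists>l. ((\<lambda>r. \<phi> (complex_of_real r * cis t)) \<longlongrightarrow> l) (at_left 1) \<and> cmod l = 1"
      using \<phi> by (simp add: inner_function_def)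
    thus "AE t in lebesgue_on {0..2 * pi}. (\<lambda>n. s n t) \<longlonglongrightarrow> (cmod (F (cis t)))\<^sup>2"
    proof eventually_elim
      case (elim t)
      then obtain l where l: "((\<lambda>r. \<phi> (complex_of_real r * cis t)) \<longlongrightarrow> l) (at_left 1)" "cmod l = 1" by blast
      have "(\<lambda>n. \<phi> (of_real (r n) * cis t)) \<longlonglongrightarrow> l" by (rule filterlim_compose[OF l(1) fl])
      moreover have "(\<lambda>n. of_real (r n) * cis t) \<longlonglongrightarrow> of_real 1 * cis t" by (intro tendsto_intros r)
      hence "(\<lambda>n. F (of_real (r n) * cis t)) \<longlonglongrightarrow> F (cis t)"
        using r(2) by (intro continuous_on_tendsto_compose[OF F(1)]) (auto simp: norm_mult less_imp_le)
      ultimately have "(\<lambda>n. s n t) \<longlonglongrightarrow> (cmod (l * F (cis t)))\<^sup>2"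
        unfolding s_def by (intro tendsto_intros)
      thus ?case using l(2) by (simp add: norm_mult)
    qed
  qed
  thus ?thesis unfolding int by (intro tendsto_intros)
qed

lemma inner_function_const_1: "inner_function (\<lambda>_. 1)"
  unfolding inner_function_def bounded_iff by (auto intro!: exI[of _ 1])

lemma norm_hardy_mult_poly:
  assumes \<phi>: "inner_function \<phi>"
  shows "norm (hardy_mult \<phi> (hardy_poly a N)) = norm (hardy_poly a N)"
proof -
  define F where "F z = (\<Sum>n<N. a n * z ^ n)" for z
  obtain r :: "nat \<Rightarrow> real" where r: "r \<longlonglongrightarrow> 1" "\<And>n. r n \<in> {0..<1}"
    using radii_to_one by blast
  have F: "continuous_on (cball 0 1) F" "F holomorphic_on ball 0 1"
    unfolding F_def by (intro continuous_intros holomorphic_intros)+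
  have "(\<lambda>n. mean_sq (hardy_fun (hardy_mult \<psi> (hardy_poly a N))) (r n)) \<longlonglongrightarrow>
      1 / (2 * pi) * (LINT t|lebesgue_on {0..2 * pi}. (cmod (F (cis t)))\<^sup>2)" if "inner_function \<psi>" for \<psi>
  proof -
    have "mean_sq (hardy_fun (hardy_mult \<psi> (hardy_poly a N))) (r n) = mean_sq (\<lambda>z. \<psi> z * F z) (r n)" for n
      by (rule mean_sq_cong[OF _ r(2)])
        (simp add: hardy_fun_mult inner_bounded_holomorphic[OF that] hardy_fun_poly F_def)
    thus ?thesis using inner_mean_sq_tendsto[OF that F r] by simp
  qed
  note lim = this
  have "hardy_mult (\<lambda>_. 1) (hardy_poly a N) = hardy_poly a N"
    by (intro hardy_eqI) (simp add: hardy_fun_mult inner_bounded_holomorphic[OF inner_function_const_1])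
  hence "(norm (hardy_mult \<phi> (hardy_poly a N)))\<^sup>2 = (norm (hardy_poly a N))\<^sup>2"
    using LIMSEQ_unique[OF lim[OF \<phi>] mean_sq_tendsto_norm[OF r]]
      LIMSEQ_unique[OF lim[OF inner_function_const_1] mean_sq_tendsto_norm[OF r]] by simp
  thus ?thesis by simp
qed

text \<open>General elements need not have continuous boundary values, so the isometry is extended from the
  polynomials by density.\<close>

lemma norm_hardy_mult:
  assumes "inner_function \<phi>"
  shows "norm (hardy_mult \<phi> f) = norm f"
proof -
  note bl = bounded_linear_hardy_mult[OF inner_bounded_holomorphic[OF assms]]
  have "(\<lambda>N. norm (hardy_mult \<phi> (hardy_poly (hardy_coeff f) N))) \<longlonglongrightarrow> norm (hardy_mult \<phi> f)"
    by (intro tendsto_norm bounded_linear.tendsto[OF bl] hardy_poly_tendsto)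
  moreover have "(\<lambda>N. norm (hardy_poly (hardy_coeff f) N)) \<longlonglongrightarrow> norm f"
    by (intro tendsto_norm hardy_poly_tendsto)
  ultimately show ?thesis unfolding norm_hardy_mult_poly[OF assms] by (rule LIMSEQ_unique)
qed

lemma norm_hardy_scale: "norm (hardy_scale c f) = cmod c * norm f"
proof -
  have "(\<lambda>n. (cmod c)\<^sup>2 * (cmod (hardy_coeff f n))\<^sup>2) sums ((cmod c)\<^sup>2 * (norm f)\<^sup>2)"
    by (intro sums_mult norm_hardy_sums)
  hence "(norm (hardy_scale c f))\<^sup>2 = (cmod c * norm f)\<^sup>2"
    using sums_unique2[OF norm_hardy_sums[of "hardy_scale c f"]]
    by (simp add: hardy_coeff_scale norm_mult power_mult_distrib)
  thus ?thesis by (simp add: power2_eq_iff_nonneg)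
qed

lemma hardy_inner_eq_Complex:
  "hardy_inner f g = Complex (inner f g) (inner (hardy_scale (- \<i>) f) g)"
  by (simp add: complex_eq_iff inner_hardy_def hardy_inner_scale_left)

text \<open>The isometry, polarized.\<close>

lemma hardy_inner_mult:
  assumes "inner_function \<phi>"
  shows "hardy_inner (hardy_mult \<phi> f) (hardy_mult \<phi> g) = hardy_inner f g"
proof -
  note bh = inner_bounded_holomorphic[OF assms]
  have "inner (hardy_mult \<phi> f) (hardy_mult \<phi> g) = inner f g" for f g
    unfolding dot_norm by (simp add: hardy_mult_add[OF bh, symmetric] norm_hardy_mult[OF assms])
  thus ?thesis unfolding hardy_inner_eq_Complex by (simp add: hardy_mult_scale[OF bh, symmetric])
qed

lemma tendsto_hardy_inner:
  assumes "X \<longlonglongrightarrow> f"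
  shows "(\<lambda>n. hardy_inner (X n) g) \<longlonglongrightarrow> hardy_inner f g"
proof -
  have "bounded_linear (hardy_scale (- \<i>))"
  proof (rule bounded_linear_intro)
    show "norm (hardy_scale (- \<i>) f) \<le> norm f * 1" for f by (simp add: norm_hardy_scale)
  qed (auto intro!: hardy_eqI simp: hardy_fun_add hardy_fun_scale scaleR_hardy_def algebra_simps)
  from bounded_linear.tendsto[OF this assms] show ?thesis
    unfolding hardy_inner_eq_Complex by (intro tendsto_Complex tendsto_inner assms tendsto_const)
qed

lemma hardy_inner_monom: "hardy_inner f (hardy_monom n) = hardy_coeff f n"
proof -
  have "(\<lambda>k. hardy_coeff f k * cnj (hardy_coeff (hardy_monom n) k)) sums
      (\<Sum>k\<in>{n}. hardy_coeff f k * cnj (hardy_coeff (hardy_monom n) k))"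
    by (rule sums_finite) (auto simp: hardy_coeff_monom)
  from sums_unique2[OF hardy_inner_sums this] show ?thesis by (simp add: hardy_coeff_monom)
qed

lemma hardy_inner_zero_left: "hardy_inner 0 g = 0"
  using hardy_inner_add_left[of 0 0 g] by simp

lemma hardy_inner_mult_poly:
  assumes "bounded_holomorphic u"
  shows "hardy_inner (hardy_mult u (hardy_poly a N)) f = (\<Sum>n<N. a n * hardy_inner (hardy_mult u (hardy_monom n)) f)"
proof (induction N)
  case 0
  have "hardy_mult u 0 = 0" using bounded_linear_hardy_mult[OF assms] by (rule linear_simps)
  thus ?case by (simp add: hardy_poly_0 hardy_inner_zero_left)
next
  case (Suc N)
  thus ?case by (simp add: hardy_poly_Suc hardy_mult_add hardy_mult_scale assms hardy_inner_add_left hardy_inner_scale_left)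
qed

section \<open>The projection onto the range of an inner function\<close>

text \<open>The adjoint of multiplication by \<open>u\<close>: its coefficients are forced by \<open>\<langle>f, u z\<^sup>n\<rangle> = \<langle>M\<^sup>* f, z\<^sup>n\<rangle>\<close>.\<close>

definition mult_adjoint :: "(complex \<Rightarrow> complex) \<Rightarrow> hardy \<Rightarrow> hardy"
  where "mult_adjoint u f = hardy_of_coeffs (\<lambda>n. hardy_inner f (hardy_mult u (hardy_monom n)))"

text \<open>The functions \<open>\<phi> z\<^sup>n\<close> are orthonormal. With \<open>p = \<Sum> \<langle>f, \<phi> z\<^sup>n\<rangle> z\<^sup>n\<close> over \<open>n < N\<close>, one has
  \<open>\<parallel>p\<parallel>\<^sup>2 = \<langle>\<phi> p, f\<rangle> \<le> \<parallel>p\<parallel> \<parallel>f\<parallel>\<close> by Cauchy--Schwarz.\<close>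

lemma bessel:
  assumes "inner_function \<phi>"
  shows "(\<Sum>n<N. (cmod (hardy_inner f (hardy_mult \<phi> (hardy_monom n))))\<^sup>2) \<le> (norm f)\<^sup>2"
proof -
  define a where "a n = hardy_inner f (hardy_mult \<phi> (hardy_monom n))" for n
  define p where "p = hardy_poly a N"
  have "hardy_inner (hardy_mult \<phi> p) f = (\<Sum>n<N. a n * cnj (a n))"
    unfolding p_def hardy_inner_mult_poly[OF inner_bounded_holomorphic[OF assms]] a_def
    by (subst hardy_inner_commute) simp
  also have "\<dots> = of_real ((norm p)\<^sup>2)"
    unfolding p_def norm_hardy_poly by (simp only: of_real_sum complex_norm_square)
  finally have "(norm p)\<^sup>2 = inner (hardy_mult \<phi> p) f" by (simp add: inner_hardy_def)
  also have "\<dots> \<le> norm p * norm f"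
    using norm_cauchy_schwarz[of "hardy_mult \<phi> p" f] by (simp add: norm_hardy_mult[OF assms])
  finally have "norm p \<le> norm f" by (cases "norm p = 0") (auto simp: power2_eq_square)
  hence "(norm p)\<^sup>2 \<le> (norm f)\<^sup>2" by (intro power_mono) auto
  thus ?thesis unfolding p_def norm_hardy_poly a_def .
qed

lemma hardy_coeff_mult_adjoint:
  assumes "inner_function \<phi>"
  shows "hardy_coeff (mult_adjoint \<phi> f) n = hardy_inner f (hardy_mult \<phi> (hardy_monom n))"
  unfolding mult_adjoint_def
  by (rule hardy_coeff_of_coeffs, rule summableI_nonneg_bounded[where x = "(norm f)\<^sup>2"]) (auto intro: bessel assms)

lemma norm_mult_adjoint_le:
  assumes "inner_function \<phi>"
  shows "norm (mult_adjoint \<phi> f) \<le> norm f"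
proof (rule power2_le_imp_le)
  show "(norm (mult_adjoint \<phi> f))\<^sup>2 \<le> (norm f)\<^sup>2"
    using norm_hardy_sums[of "mult_adjoint \<phi> f"] unfolding sums_def hardy_coeff_mult_adjoint[OF assms]
    by (rule LIMSEQ_le_const2) (use bessel[OF assms] in blast)
qed simp

lemma mult_adjoint:
  assumes "inner_function \<phi>"
  shows "hardy_inner (hardy_mult \<phi> u) f = hardy_inner u (mult_adjoint \<phi> f)"
proof (rule LIMSEQ_unique)
  note bh = inner_bounded_holomorphic[OF assms]
  show "(\<lambda>N. hardy_inner (hardy_mult \<phi> (hardy_poly (hardy_coeff u) N)) f) \<longlonglongrightarrow> hardy_inner (hardy_mult \<phi> u) f"
    by (intro tendsto_hardy_inner bounded_linear.tendsto[OF bounded_linear_hardy_mult[OF bh]] hardy_poly_tendsto)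
  have "cnj (hardy_coeff (mult_adjoint \<phi> f) n) = hardy_inner (hardy_mult \<phi> (hardy_monom n)) f" for n
    unfolding hardy_coeff_mult_adjoint[OF assms] by (rule hardy_inner_commute[symmetric])
  thus "(\<lambda>N. hardy_inner (hardy_mult \<phi> (hardy_poly (hardy_coeff u) N)) f) \<longlonglongrightarrow> hardy_inner u (mult_adjoint \<phi> f)"
    using hardy_inner_sums[of u "mult_adjoint \<phi> f"] unfolding sums_def hardy_inner_mult_poly[OF bh] by simp
qed

lemma mult_adjoint_add: "inner_function \<phi> \<Longrightarrow> mult_adjoint \<phi> (f + g) = mult_adjoint \<phi> f + mult_adjoint \<phi> g"
  and mult_adjoint_scale: "inner_function \<phi> \<Longrightarrow> mult_adjoint \<phi> (hardy_scale c f) = hardy_scale c (mult_adjoint \<phi> f)"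
  by (intro hardy_eq_coeffI; simp add: hardy_coeff_mult_adjoint hardy_coeff_add hardy_coeff_scale
      hardy_inner_add_left hardy_inner_scale_left)+

lemma mult_adjoint_mult: "inner_function \<phi> \<Longrightarrow> mult_adjoint \<phi> (hardy_mult \<phi> f) = f"
  by (intro hardy_eq_coeffI) (simp add: hardy_coeff_mult_adjoint hardy_inner_mult hardy_inner_monom)

definition range_proj :: "(complex \<Rightarrow> complex) \<Rightarrow> hardy \<Rightarrow>\<^sub>L hardy"
  where "range_proj \<phi> = Blinfun (\<lambda>f. hardy_mult \<phi> (mult_adjoint \<phi> f))"

lemma range_proj_apply:
  assumes "inner_function \<phi>"
  shows "blinfun_apply (range_proj \<phi>) f = hardy_mult \<phi> (mult_adjoint \<phi> f)"
proof -
  note bh = inner_bounded_holomorphic[OF assms]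
  have "bounded_linear (\<lambda>f. hardy_mult \<phi> (mult_adjoint \<phi> f))"
  proof (rule bounded_linear_intro)
    show "norm (hardy_mult \<phi> (mult_adjoint \<phi> f)) \<le> norm f * 1" for f
      by (simp add: norm_hardy_mult norm_mult_adjoint_le assms)
  qed (simp_all add: mult_adjoint_add mult_adjoint_scale hardy_mult_add hardy_mult_scale scaleR_hardy_def assms bh)
  thus ?thesis unfolding range_proj_def by (simp add: bounded_linear_Blinfun_apply)
qed

lemma range_proj_orthogonal:
  assumes "inner_function \<phi>"
  shows "orthogonal_projection (range_proj \<phi>)"
  unfolding orthogonal_projection_def
proof (intro conjI allI)
  note bh = inner_bounded_holomorphic[OF assms]
  show "blinfun_apply (range_proj \<phi>) (hardy_scale c f) = hardy_scale c (blinfun_apply (range_proj \<phi>) f)" for c f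
    by (simp add: range_proj_apply assms mult_adjoint_scale hardy_mult_scale bh)
  show "range_proj \<phi> o\<^sub>L range_proj \<phi> = range_proj \<phi>"
    by (intro blinfun_eqI) (simp add: range_proj_apply assms mult_adjoint_mult)
  have "hardy_inner (blinfun_apply (range_proj \<phi>) f) g = hardy_inner (mult_adjoint \<phi> f) (mult_adjoint \<phi> g)" for f g
    by (simp add: range_proj_apply assms mult_adjoint)
  thus "hardy_inner (blinfun_apply (range_proj \<phi>) f) g = hardy_inner f (blinfun_apply (range_proj \<phi>) g)" for f g
    by (metis hardy_inner_commute complex_cnj_cnj)
qed

lemma mult_hardy_eq_range:
  assumes "bounded_holomorphic \<phi>"
  shows "mult_hardy \<phi> = range (hardy_mult \<phi>)"
proof -
  have "f = hardy_mult \<phi> g \<longleftrightarrow> (\<forall>z\<in>ball 0 1. hardy_fun f z = \<phi> z * hardy_fun g z)" for f g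
    using hardy_eqI[of f "hardy_mult \<phi> g"] by (auto simp: hardy_fun_mult[OF assms])
  thus ?thesis unfolding mult_hardy_def by auto
qed

lemma range_proj_range:
  assumes "inner_function \<phi>"
  shows "range (blinfun_apply (range_proj \<phi>)) = mult_hardy \<phi>"
proof -
  have "hardy_mult \<phi> g = blinfun_apply (range_proj \<phi>) (hardy_mult \<phi> g)" for g
    by (simp add: range_proj_apply assms mult_adjoint_mult)
  thus ?thesis
    unfolding mult_hardy_eq_range[OF inner_bounded_holomorphic[OF assms]]
    by (auto simp: range_proj_apply[OF assms] image_iff)
qed

lemma range_proj_nontrivial:
  assumes \<phi>: "inner_function \<phi>" and z: "z \<in> ball 0 1" "\<phi> z = 0"
  shows "nontrivial_projection (range_proj \<phi>)"
  unfolding nontrivial_projection_def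
proof (intro conjI notI)
  note b = inner_bounded_holomorphic[OF \<phi>]
  show "orthogonal_projection (range_proj \<phi>)" by (rule range_proj_orthogonal[OF \<phi>])
  let ?g = "hardy_mult \<phi> (hardy_monom 0)"
  have "blinfun_apply (range_proj \<phi>) ?g = ?g" by (simp add: range_proj_apply \<phi> mult_adjoint_mult)
  moreover have "norm ?g = 1" by (simp add: norm_hardy_mult \<phi> norm_hardy_monom)
  moreover assume "range_proj \<phi> = 0"
  ultimately show False by simp
next
  note b = inner_bounded_holomorphic[OF \<phi>]
  assume "range_proj \<phi> = id_blinfun"
  hence "hardy_monom 0 = hardy_mult \<phi> (mult_adjoint \<phi> (hardy_monom 0))"
    using range_proj_apply[OF \<phi>, of "hardy_monom 0"] by simp
  hence "hardy_fun (hardy_monom 0) z = \<phi> z * hardy_fun (mult_adjoint \<phi> (hardy_monom 0)) z"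
    using hardy_fun_mult[OF b z(1)] by metis
  thus False using z by (simp add: hardy_fun_monom)
qed

lemma range_proj_invariant:
  assumes "inner_function \<phi>"
  shows "mult_z ` range (blinfun_apply (range_proj \<phi>)) \<subseteq> range (blinfun_apply (range_proj \<phi>))"
proof -
  note b = inner_bounded_holomorphic[OF assms]
  have "mult_z (hardy_mult \<phi> g) = hardy_mult \<phi> (mult_z g)" for g by (simp add: hardy_mult_mult_z b)
  thus ?thesis unfolding range_proj_range[OF assms] mult_hardy_eq_range[OF b] by auto
qed

lemma orthogonal_projection_idem: "orthogonal_projection p \<Longrightarrow> blinfun_apply p (blinfun_apply p f) = blinfun_apply p f"
  unfolding orthogonal_projection_def by (metis blinfun_apply_blinfun_compose)

lemma orthogonal_projection_inner: "orthogonal_projection p \<Longrightarrow> inner (blinfun_apply p f) g = inner f (blinfun_apply p g)"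
  unfolding orthogonal_projection_def inner_hardy_def by metis

lemma norm_orthogonal_complement_le:
  assumes "orthogonal_projection p"
  shows "norm (f - blinfun_apply p f) \<le> norm f"
proof (rule power2_le_imp_le)
  have "inner (blinfun_apply p f) (blinfun_apply p f) = inner f (blinfun_apply p f)"
    by (simp add: orthogonal_projection_inner orthogonal_projection_idem assms)
  hence "(norm (f - blinfun_apply p f))\<^sup>2 = (norm f)\<^sup>2 - (norm (blinfun_apply p f))\<^sup>2"
    by (simp add: power2_norm_eq_inner inner_diff inner_commute)
  thus "(norm (f - blinfun_apply p f))\<^sup>2 \<le> (norm f)\<^sup>2" by simp
qed simp

text \<open>Write \<open>p - q = (1 - q) p - q (1 - p)\<close>. The first term is bounded by hypothesis and the second is the
  adjoint of \<open>(1 - p) q\<close>.\<close>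

lemma norm_projection_diff_le:
  assumes p: "orthogonal_projection p" and q: "orthogonal_projection q"
    and pq: "\<And>f. norm (blinfun_apply p f - blinfun_apply q (blinfun_apply p f)) \<le> \<epsilon> * norm f"
    and qp: "\<And>f. norm (blinfun_apply q f - blinfun_apply p (blinfun_apply q f)) \<le> \<epsilon> * norm f"
    and \<epsilon>: "0 \<le> \<epsilon>"
  shows "norm (p - q) \<le> 2 * \<epsilon>"
proof (rule norm_blinfun_bound)
  fix f
  define v where "v = blinfun_apply q (f - blinfun_apply p f)"
  have qv: "blinfun_apply q v = v" by (simp add: v_def orthogonal_projection_idem[OF q])
  have "(norm v)\<^sup>2 = inner (f - blinfun_apply p f) v"
    unfolding power2_norm_eq_inner by (subst (1) v_def) (simp add: orthogonal_projection_inner[OF q] qv)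
  also have "\<dots> = inner f (v - blinfun_apply p v)"
    by (simp add: inner_diff orthogonal_projection_inner[OF p])
  also have "\<dots> \<le> norm f * norm (v - blinfun_apply p v)" by (rule norm_cauchy_schwarz)
  also have "\<dots> \<le> norm f * (\<epsilon> * norm v)" using qp[of v] unfolding qv by (intro mult_left_mono) auto
  finally have "norm v \<le> \<epsilon> * norm f"
    using \<epsilon> by (cases "norm v = 0") (auto simp: power2_eq_square mult_ac)
  moreover have "blinfun_apply (p - q) f = (blinfun_apply p f - blinfun_apply q (blinfun_apply p f)) - v"
    by (simp add: v_def blinfun.diff_left blinfun.diff_right)
  hence "norm (blinfun_apply (p - q) f) \<le> norm (blinfun_apply p f - blinfun_apply q (blinfun_apply p f)) + norm v"
    by (simp only: norm_triangle_ineq4)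
  ultimately show "norm (blinfun_apply (p - q) f) \<le> 2 * \<epsilon> * norm f" using pq[of f] by simp
qed (use \<epsilon> in simp)

text \<open>If \<open>\<phi>\<close> is approximately divisible by \<open>\<psi>\<close>, then \<open>\<phi> g\<close> is near the element \<open>\<psi> h g\<close> of \<open>\<psi> H\<^sup>2\<close>, and the
  projection onto \<open>\<psi> H\<^sup>2\<close> moves it by no more than that distance.\<close>

lemma range_proj_approx:
  assumes \<phi>: "inner_function \<phi>" and \<psi>: "inner_function \<psi>" and h: "bounded_holomorphic h"
    and le: "\<And>z. z \<in> ball 0 1 \<Longrightarrow> cmod (\<phi> z - \<psi> z * h z) \<le> \<epsilon>"
  shows "norm (blinfun_apply (range_proj \<phi>) f - blinfun_apply (range_proj \<psi>) (blinfun_apply (range_proj \<phi>) f)) \<le> \<epsilon> * norm f"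
proof -
  note b = inner_bounded_holomorphic[OF \<phi>] inner_bounded_holomorphic[OF \<psi>]
  have hol: "(\<lambda>z. \<phi> z - \<psi> z * h z) holomorphic_on ball 0 1"
    using b h unfolding bounded_holomorphic_def by (intro holomorphic_intros) auto
  have bd: "bounded_holomorphic (\<lambda>z. \<phi> z - \<psi> z * h z)"
    unfolding bounded_holomorphic_def by (intro conjI hol boundedI[of _ \<epsilon>]) (use le in blast)
  have \<epsilon>: "0 \<le> \<epsilon>" using order_trans[OF norm_ge_zero le[of 0]] by simp
  define g where "g = mult_adjoint \<phi> f"
  define x where "x = hardy_mult \<phi> g"
  define v where "v = hardy_mult \<psi> (hardy_mult h g)"
  have x: "blinfun_apply (range_proj \<phi>) f = x" by (simp add: x_def g_def range_proj_apply[OF \<phi>])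
  have v: "blinfun_apply (range_proj \<psi>) v = v" by (simp add: v_def range_proj_apply[OF \<psi>] mult_adjoint_mult[OF \<psi>])
  have xv: "x - v = hardy_mult (\<lambda>z. \<phi> z - \<psi> z * h z) g"
    by (rule hardy_eqI)
      (simp add: x_def v_def hardy_fun_diff hardy_fun_mult b h bd algebra_simps)
  have "x - blinfun_apply (range_proj \<psi>) x = (x - v) - blinfun_apply (range_proj \<psi>) (x - v)"
    by (simp add: blinfun.diff_right v)
  also have "norm \<dots> \<le> norm (x - v)"
    by (rule norm_orthogonal_complement_le[OF range_proj_orthogonal[OF \<psi>]])
  also have "\<dots> \<le> \<epsilon> * norm g" unfolding xv by (rule norm_hardy_mult_le[OF hol le])
  also have "\<dots> \<le> \<epsilon> * norm f" unfolding g_def by (intro mult_left_mono norm_mult_adjoint_le \<phi> \<epsilon>)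
  finally show ?thesis unfolding x .
qed

section \<open>Inner functions with the same range\<close>

text \<open>Up to scalars, \<open>\<phi>\<close> is the only element of \<open>\<phi> H\<^sup>2\<close> orthogonal to \<open>z \<phi> H\<^sup>2\<close>, and the latter space
  depends on \<open>\<phi> H\<^sup>2\<close> only. So \<open>\<psi> = \<phi> g\<close> forces all coefficients of \<open>g\<close> but the first to vanish.\<close>

lemma inner_function_unique:
  assumes \<phi>: "inner_function \<phi>" and \<psi>: "inner_function \<psi>" and eq: "mult_hardy \<phi> = mult_hardy \<psi>"
  obtains c where "cmod c = 1" "\<And>z. z \<in> ball 0 1 \<Longrightarrow> \<psi> z = c * \<phi> z"
proof -
  note b = inner_bounded_holomorphic[OF \<phi>] inner_bounded_holomorphic[OF \<psi>]
  have ran: "range (hardy_mult \<phi>) = range (hardy_mult \<psi>)"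
    using eq b by (simp add: mult_hardy_eq_range)
  then obtain g where g: "hardy_mult \<psi> (hardy_monom 0) = hardy_mult \<phi> g" by blast
  have coeff: "hardy_coeff g (Suc n) = 0" for n
  proof -
    \<comment> \<open>Thus \<open>\<phi> z\<^sup>n\<^sup>+\<^sup>1 = \<psi> z k\<close>, which is orthogonal to \<open>\<psi>\<close>.\<close>
    obtain k where k: "hardy_mult \<phi> (hardy_monom n) = hardy_mult \<psi> k" using ran by blast
    have "hardy_coeff g (Suc n) = hardy_inner (hardy_mult \<phi> g) (hardy_mult \<phi> (hardy_monom (Suc n)))"
      by (simp add: hardy_inner_mult[OF \<phi>] hardy_inner_monom)
    also have "hardy_mult \<phi> (hardy_monom (Suc n)) = hardy_mult \<psi> (mult_z k)"
      by (simp add: hardy_monom_Suc hardy_mult_mult_z b k)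
    also have "hardy_inner (hardy_mult \<phi> g) (hardy_mult \<psi> (mult_z k)) = hardy_inner (hardy_monom 0) (mult_z k)"
      unfolding g[symmetric] by (rule hardy_inner_mult[OF \<psi>])
    also have "\<dots> = 0"
      by (subst hardy_inner_commute) (simp add: hardy_inner_monom hardy_coeff_mult_z_0)
    finally show ?thesis .
  qed
  define c where "c = hardy_coeff g 0"
  have gc: "g = hardy_scale c (hardy_monom 0)"
  proof (rule hardy_eq_coeffI)
    show "hardy_coeff g n = hardy_coeff (hardy_scale c (hardy_monom 0)) n" for n
      by (cases n) (simp_all add: coeff c_def hardy_coeff_scale hardy_coeff_monom)
  qed
  show thesis
  proof
    have "norm g = 1"
      using arg_cong[OF g, of norm] by (simp add: norm_hardy_mult \<phi> \<psi> norm_hardy_monom)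
    thus "cmod c = 1" unfolding gc by (simp add: norm_hardy_scale norm_hardy_monom)
    fix z :: complex assume z: "z \<in> ball 0 1"
    have "hardy_fun (hardy_mult \<psi> (hardy_monom 0)) z = hardy_fun (hardy_mult \<phi> g) z" by (simp only: g)
    thus "\<psi> z = c * \<phi> z"
      using z by (simp add: hardy_fun_mult b gc hardy_fun_scale hardy_fun_monom)
  qed
qed

section \<open>Blaschke factors with zeros on a ray\<close>

text \<open>The zeros in the coordinate \<open>\<zeta> = (1 - z) / (1 + z)\<close> of the right half-plane. The numerator
  \<open>\<zeta> - c\<close> and the denominator \<open>\<zeta> + cnj c\<close> of a Blaschke factor of the half-plane are multiplied by
  \<open>1 + z\<close> below, so that they are polynomials in \<open>z\<close> and \<open>z = - 1\<close> is no exception.\<close>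

definition half_plane_zero :: "real \<Rightarrow> nat \<Rightarrow> complex"
  where "half_plane_zero a k = (1/2) ^ k * cis a"
definition factor_den :: "real \<Rightarrow> nat \<Rightarrow> complex \<Rightarrow> complex"
  where "factor_den a k z = (1 - z) + cnj (half_plane_zero a k) * (1 + z)"
definition factor_num :: "real \<Rightarrow> nat \<Rightarrow> complex \<Rightarrow> complex"
  where "factor_num a k z = (1 - z) - half_plane_zero a k * (1 + z)"

lemma norm_half_plane_zero [simp]: "cmod (half_plane_zero a k) = (1/2) ^ k"
  by (simp add: half_plane_zero_def norm_mult norm_power norm_divide)

lemma Re_half_plane_zero: "Re (half_plane_zero a k) = (1/2) ^ k * cos a"
  and Im_half_plane_zero: "Im (half_plane_zero a k) = (1/2) ^ k * sin a"
proof -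
  have "half_plane_zero a k = of_real ((1/2)^k) * cis a" by (simp add: half_plane_zero_def)
  thus "Re (half_plane_zero a k) = (1/2) ^ k * cos a" "Im (half_plane_zero a k) = (1/2) ^ k * sin a"
    by (simp_all del: of_real_power of_real_divide)
qed

text \<open>The range of angles is chosen such that \<open>sin a \<le> 1 / 2\<close>: then the mixed term in
  \<open>norm_factor_den_sq\<close> costs at most half of the two squares, which gives \<open>factor_den_lower\<close>.\<close>

lemma angle_bounds:
  assumes "a \<in> {0..1/2::real}"
  shows "0 \<le> sin a" "sin a \<le> 1/2" "0 < cos a"
proof -
  show "0 \<le> sin a" using assms pi_gt3 by (intro sin_ge_zero) auto
  show "sin a \<le> 1/2" using sin_x_le_x[of a] assms by auto
  show "0 < cos a" using assms pi_gt3 by (intro cos_gt_zero_pi) auto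
qed

lemma cmod_add_sq: "(cmod (u + v))\<^sup>2 = (cmod u)\<^sup>2 + (cmod v)\<^sup>2 + 2 * Re (u * cnj v)"
  unfolding cmod_power2 by (simp add: power2_eq_square algebra_simps)

lemma norm_factor_den_sq:
  "(cmod (factor_den a k z))\<^sup>2 = (cmod (1 - z))\<^sup>2 + ((1/2) ^ k * cmod (1 + z))\<^sup>2
     + 2 * (1/2) ^ k * ((1 - (cmod z)\<^sup>2) * cos a + 2 * Im z * sin a)"
proof -
  have "Re ((1 - z) * cnj (cnj (half_plane_zero a k) * (1 + z)))
      = (1/2) ^ k * ((1 - (cmod z)\<^sup>2) * cos a + 2 * Im z * sin a)"
    by (simp add: Re_half_plane_zero Im_half_plane_zero cmod_power2 algebra_simps) (simp add: power2_eq_square algebra_simps)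
  moreover have "cmod (cnj (half_plane_zero a k) * (1 + z)) = (1/2) ^ k * cmod (1 + z)"
    by (simp add: norm_mult)
  ultimately show ?thesis unfolding factor_den_def cmod_add_sq by simp
qed

lemma norm_factor_num_sq:
  "(cmod (factor_num a k z))\<^sup>2 = (cmod (1 - z))\<^sup>2 + ((1/2) ^ k * cmod (1 + z))\<^sup>2
     + 2 * (1/2) ^ k * (- (1 - (cmod z)\<^sup>2) * cos a + 2 * Im z * sin a)"
proof -
  have "Re ((1 - z) * cnj (- (half_plane_zero a k * (1 + z))))
      = (1/2) ^ k * (- (1 - (cmod z)\<^sup>2) * cos a + 2 * Im z * sin a)"
    by (simp add: Re_half_plane_zero Im_half_plane_zero cmod_power2 algebra_simps) (simp add: power2_eq_square algebra_simps)
  moreover have "cmod (- (half_plane_zero a k * (1 + z))) = (1/2) ^ k * cmod (1 + z)"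
    by (simp add: norm_mult)
  ultimately show ?thesis unfolding factor_num_def diff_conv_add_uminus[of "1 - z"] cmod_add_sq by simp
qed

text \<open>The imaginary part of \<open>(1 - z) cnj (1 + z)\<close> is \<open>- 2 Im z\<close>.\<close>

lemma abs_Im_le:
  assumes "cmod z \<le> 1"
  shows "2 * \<bar>Im z\<bar> \<le> cmod (1 - z) * cmod (1 + z)"
proof -
  have "\<bar>Im ((1 - z) * cnj (1 + z))\<bar> \<le> cmod ((1 - z) * cnj (1 + z))" by (rule abs_Im_le_cmod)
  also have "\<dots> = cmod (1 - z) * cmod (1 + z)" unfolding norm_mult complex_mod_cnj ..
  also have "Im ((1 - z) * cnj (1 + z)) = - 2 * Im z" by (simp add: algebra_simps)
  finally show ?thesis by simp
qed

lemma factor_den_lower: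
  assumes "a \<in> {0..1/2}" "cmod z \<le> 1"
  shows "((cmod (1 - z))\<^sup>2 + ((1/2) ^ k * cmod (1 + z))\<^sup>2) / 2 \<le> (cmod (factor_den a k z))\<^sup>2"
proof -
  define A Y where "A = cmod (1 - z)" and "Y = (1/2) ^ k * cmod (1 + z)"
  note b = angle_bounds[OF assms(1)]
  have 1: "2 * (1/2)^k * \<bar>2 * Im z * sin a\<bar> \<le> A * Y"
  proof -
    have "2 * (1/2)^k * \<bar>2 * Im z * sin a\<bar> = 2 * (1/2)^k * (2 * \<bar>Im z\<bar> * sin a)"
      using b by (simp add: abs_mult)
    also have "\<dots> \<le> 2 * (1/2)^k * ((cmod (1 - z) * cmod (1 + z)) * (1/2))"
      using b abs_Im_le[OF assms(2)] by (intro mult_left_mono[of _ _ "2 * (1/2)^k"] mult_mono[of "2 * \<bar>Im z\<bar>"]) auto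
    finally show ?thesis by (simp add: A_def Y_def mult_ac)
  qed
  have 2: "0 \<le> 2 * (1/2)^k * ((1 - (cmod z)\<^sup>2) * cos a)"
    using b assms(2) by (auto simp: power_le_one)
  have 3: "2 * A * Y \<le> A\<^sup>2 + Y\<^sup>2" by (rule sum_squares_bound)
  have 4: "- (2 * (1/2)^k * \<bar>2 * Im z * sin a\<bar>) \<le> 2 * (1/2)^k * (2 * Im z * sin a)"
    by (smt (verit, best) mult_minus_right mult_left_mono zero_le_power divide_nonneg_nonneg)
  have 5: "(cmod (factor_den a k z))\<^sup>2 = A\<^sup>2 + Y\<^sup>2 + 2 * (1/2)^k * ((1 - (cmod z)\<^sup>2) * cos a)
     + 2 * (1/2)^k * (2 * Im z * sin a)"
    unfolding norm_factor_den_sq A_def Y_def by (simp only: distrib_left add.assoc)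
  have arith: "(p + q) / 2 \<le> d" if "w \<le> AY" "0 \<le> v" "2 * AY \<le> p + q" "- w \<le> u" "d = p + q + v + u"
    for p q d w v u AY :: real using that by argo
  show ?thesis unfolding A_def[symmetric] Y_def[symmetric]
    by (rule arith[OF 1 2 _ 4 5]) (use 3 in \<open>simp add: mult.assoc\<close>)
qed

lemma factor_den_nz:
  assumes "a \<in> {0..1/2}" "cmod z \<le> 1"
  shows "factor_den a k z \<noteq> 0"
proof
  assume "factor_den a k z = 0"
  with factor_den_lower[OF assms, of k] have "(cmod (1 - z))\<^sup>2 + ((1/2) ^ k * cmod (1 + z))\<^sup>2 \<le> 0" by simp
  hence "1 - z = 0" "1 + z = 0"
    by (auto simp add: add_nonneg_eq_0_iff order.antisym sum_power2_le_zero_iff)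
  thus False by (simp add: add_eq_0_iff)
qed

lemma norm_factor_den_ge:
  assumes "a \<in> {0..1/2}" "cmod z \<le> 1"
  shows "cmod (1 - z) \<le> 2 * cmod (factor_den a k z)"
proof (rule power2_le_imp_le)
  show "(cmod (1 - z))\<^sup>2 \<le> (2 * cmod (factor_den a k z))\<^sup>2"
  proof -
    have "p \<le> 4 * d" if "(p + q) / 2 \<le> d" "0 \<le> q" "0 \<le> p" for p q d :: real
      using that by argo
    from this[OF factor_den_lower[OF assms, of k]] show ?thesis
      unfolding power_mult_distrib[of 2 "cmod (factor_den a k z)"] by simp
  qed
qed auto

lemma norm_factor_num_le:
  assumes "a \<in> {0..1/2}" "cmod z \<le> 1"
  shows "cmod (factor_num a k z) \<le> cmod (factor_den a k z)"
proof (rule power2_le_imp_le)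
  have "0 \<le> (1/2::real)^k * ((1 - (cmod z)\<^sup>2) * cos a)"
    using angle_bounds[OF assms(1)] assms(2) by (auto simp: power_le_one)
  thus "(cmod (factor_num a k z))\<^sup>2 \<le> (cmod (factor_den a k z))\<^sup>2"
    unfolding norm_factor_den_sq norm_factor_num_sq by (simp add: algebra_simps)
qed auto

text \<open>A Blaschke factor is unimodular on the circle, since its numerator and denominator are conjugate up
  to a unimodular factor.\<close>

lemma factor_num_circle:
  assumes "cmod z = 1"
  shows "factor_num a k z = - z * cnj (factor_den a k z)"
proof -
  have "z * cnj z = 1" using assms by (simp add: complex_norm_square[symmetric])
  thus ?thesis by (simp add: factor_num_def factor_den_def algebra_simps)
qed

definition blaschke_factor :: "real \<Rightarrow> nat \<Rightarrow> complex \<Rightarrow> complex"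
  where "blaschke_factor a k z = factor_num a k z / factor_den a k z"
definition blaschke :: "real \<Rightarrow> complex \<Rightarrow> complex"
  where "blaschke a z = lim (\<lambda>n. \<Prod>k<n. blaschke_factor a k z)"
text \<open>The square of \<open>q\<close>, the holomorphic factor without zeros which carries the factor of angle \<open>a\<close> to that
  of angle \<open>s\<close>, up to its modulus; see \<open>blaschke_times_outer_circle\<close>.\<close>

definition outer_factor :: "real \<Rightarrow> real \<Rightarrow> nat \<Rightarrow> complex \<Rightarrow> complex"
  where "outer_factor s a k z = (factor_den a k z / factor_den s k z)\<^sup>2"

lemma factor_den_holomorphic [holomorphic_intros]: "factor_den a k holomorphic_on A"
  and factor_num_holomorphic [holomorphic_intros]: "factor_num a k holomorphic_on A"
  unfolding factor_den_def factor_num_def by (intro holomorphic_intros)+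

lemma blaschke_factor_holomorphic:
  "a \<in> {0..1/2} \<Longrightarrow> blaschke_factor a k holomorphic_on cball 0 1"
  unfolding blaschke_factor_def using factor_den_nz by (auto intro!: holomorphic_intros)

lemma outer_factor_holomorphic:
  "s \<in> {0..1/2} \<Longrightarrow> outer_factor s a k holomorphic_on cball 0 1"
  unfolding outer_factor_def using factor_den_nz by (auto intro!: holomorphic_intros)

lemma blaschke_factor_norm_le:
  assumes "a \<in> {0..1/2}" "cmod z \<le> 1"
  shows "cmod (blaschke_factor a k z) \<le> 1"
  using norm_factor_num_le[OF assms, of k] factor_den_nz[OF assms, of k]
  by (simp add: blaschke_factor_def norm_divide divide_le_eq_1)

lemma blaschke_factor_norm_circle:
  assumes "a \<in> {0..1/2}" "cmod z = 1"
  shows "cmod (blaschke_factor a k z) = 1"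
  using factor_num_circle[OF assms(2), of a k] factor_den_nz[of a z k] assms
  by (simp add: blaschke_factor_def norm_divide norm_mult)

lemma norm_one_plus_le: "cmod z \<le> 1 \<Longrightarrow> cmod (1 + z) \<le> 2"
  using norm_triangle_ineq[of 1 z] by simp

lemma den_quotient_bound:
  assumes "a \<in> {0..1/2}" "cmod z \<le> 1" "cmod w \<le> 4 * (1/2) ^ k"
  shows "cmod (w / factor_den a k z) * cmod (1 - z) \<le> 8 * (1/2) ^ k"
proof -
  have "cmod (w / factor_den a k z) * cmod (1 - z) \<le> cmod (w / factor_den a k z) * (2 * cmod (factor_den a k z))"
    using norm_factor_den_ge[OF assms(1,2), of k] by (intro mult_left_mono) auto
  also have "\<dots> = 2 * cmod w" using factor_den_nz[OF assms(1,2)] by (simp add: norm_divide)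
  finally show ?thesis using assms(3) by linarith
qed

lemma cmult_one_plus_bound:
  assumes "cmod c \<le> 2 * (1/2) ^ k" "cmod z \<le> 1"
  shows "cmod (c * (1 + z)) \<le> 4 * (1/2) ^ k"
proof -
  have "cmod (c * (1 + z)) \<le> (2 * (1/2) ^ k) * 2"
    unfolding norm_mult using assms norm_one_plus_le[of z] by (intro mult_mono) auto
  thus ?thesis by simp
qed

lemma blaschke_factor_near_one:
  assumes "a \<in> {0..1/2}" "cmod z \<le> 1"
  shows "cmod (blaschke_factor a k z - 1) * cmod (1 - z) \<le> 8 * (1/2) ^ k"
proof -
  have "blaschke_factor a k z - 1 = - (half_plane_zero a k + cnj (half_plane_zero a k)) * (1 + z) / factor_den a k z"
    using factor_den_nz[OF assms, of k]
    by (simp add: blaschke_factor_def field_simps) (simp add: factor_num_def factor_den_def algebra_simps)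
  moreover have "cmod (- (half_plane_zero a k + cnj (half_plane_zero a k))) \<le> 2 * (1/2) ^ k"
    using norm_triangle_ineq[of "half_plane_zero a k" "cnj (half_plane_zero a k)"] by (simp only: norm_minus_cancel complex_mod_cnj norm_half_plane_zero)
  ultimately show ?thesis
    using den_quotient_bound[OF assms cmult_one_plus_bound[OF _ assms(2)]] by simp
qed

lemma den_ratio_norm_le:
  assumes "s \<in> {0..1/2}" "cmod z \<le> 1"
  shows "cmod (factor_den a k z / factor_den s k z) \<le> 2"
proof -
  let ?A = "cmod (1 - z)" and ?Y = "(1/2) ^ k * cmod (1 + z)"
  have "cmod (factor_den a k z) \<le> ?A + ?Y"
    unfolding factor_den_def using norm_triangle_ineq[of "1 - z" "cnj (half_plane_zero a k) * (1 + z)"] by (simp add: norm_mult)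
  hence "(cmod (factor_den a k z))\<^sup>2 \<le> (?A + ?Y)\<^sup>2" by (intro power_mono) auto
  also have "\<dots> = ?A\<^sup>2 + ?Y\<^sup>2 + 2 * ?A * ?Y" by (simp add: power2_sum)
  also have "\<dots> \<le> 4 * ((?A\<^sup>2 + ?Y\<^sup>2) / 2)"
    using sum_squares_bound[of ?A ?Y] by argo
  also have "\<dots> \<le> 4 * (cmod (factor_den s k z))\<^sup>2"
    using factor_den_lower[OF assms, of k] by (intro mult_left_mono) auto
  also have "\<dots> = (2 * cmod (factor_den s k z))\<^sup>2" by (simp add: power_mult_distrib)
  finally have "cmod (factor_den a k z) \<le> 2 * cmod (factor_den s k z)"
    by (rule power2_le_imp_le) auto
  thus ?thesis using factor_den_nz[OF assms, of k] by (simp add: norm_divide field_simps)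
qed

lemma outer_factor_near_one:
  assumes "s \<in> {0..1/2}" "cmod z \<le> 1"
  shows "cmod (outer_factor s a k z - 1) * cmod (1 - z) \<le> 24 * (1/2) ^ k"
proof -
  let ?q = "factor_den a k z / factor_den s k z"
  have "?q - 1 = (cnj (half_plane_zero a k) - cnj (half_plane_zero s k)) * (1 + z) / factor_den s k z"
    using factor_den_nz[OF assms, of k] by (simp add: field_simps) (simp add: factor_den_def algebra_simps)
  moreover have "cmod (cnj (half_plane_zero a k) - cnj (half_plane_zero s k)) \<le> 2 * (1/2) ^ k"
    using norm_triangle_ineq4[of "cnj (half_plane_zero a k)" "cnj (half_plane_zero s k)"] by (simp only: complex_mod_cnj norm_half_plane_zero)
  ultimately have 1: "cmod (?q - 1) * cmod (1 - z) \<le> 8 * (1/2) ^ k"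
    using den_quotient_bound[OF assms cmult_one_plus_bound[OF _ assms(2)]] by simp
  have 2: "cmod (?q + 1) \<le> 3"
    using den_ratio_norm_le[OF assms, of a k] norm_triangle_ineq[of ?q 1] by simp
  have "outer_factor s a k z - 1 = (?q + 1) * (?q - 1)"
    by (simp add: outer_factor_def power2_eq_square algebra_simps)
  hence "cmod (outer_factor s a k z - 1) * cmod (1 - z) = cmod (?q + 1) * (cmod (?q - 1) * cmod (1 - z))"
    by (simp add: norm_mult)
  also have "\<dots> \<le> 3 * (8 * (1/2) ^ k)" by (rule mult_mono[OF 2 1]) auto
  finally show ?thesis by simp
qed

section \<open>The infinite Blaschke products\<close>

text \<open>The partial products are uniformly bounded, so their increments are bounded by the distances of the
  factors from \<open>1\<close>, and the Weierstrass test applies away from the point \<open>1\<close>. Working with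
  increments rather than logarithms tolerates zeros, so that the Blaschke products and the
  products of the outer factors are treated alike.\<close>

lemma product_limit_disc:
  fixes f :: "nat \<Rightarrow> complex \<Rightarrow> complex"
  assumes M: "\<And>n z. cmod z \<le> 1 \<Longrightarrow> cmod (\<Prod>k<n. f k z) \<le> M"
    and C: "\<And>k z. cmod z \<le> 1 \<Longrightarrow> cmod (f k z - 1) * cmod (1 - z) \<le> C * (1/2) ^ k"
    and cont: "\<And>k. continuous_on (cball 0 1) (f k)"
    and hol: "\<And>k. f k holomorphic_on ball 0 1"
  defines "F \<equiv> \<lambda>z. lim (\<lambda>n. \<Prod>k<n. f k z)"
  shows "\<And>z. cmod z \<le> 1 \<Longrightarrow> z \<noteq> 1 \<Longrightarrow> (\<lambda>n. \<Prod>k<n. f k z) \<longlonglongrightarrow> F z"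
    and "continuous_on (cball 0 1 - {1}) F"
    and "F holomorphic_on ball 0 1"
proof -
  have M0: "0 \<le> M" using M[of 0 0] by simp
  have ul: "uniform_limit {z. cmod z \<le> 1 \<and> \<delta> \<le> cmod (1 - z)} (\<lambda>n z. \<Prod>k<n. f k z) F sequentially"
    if d: "\<delta> > 0" for \<delta>
  proof -
    let ?S = "{z. cmod z \<le> 1 \<and> \<delta> \<le> cmod (1 - z)}"
    let ?g = "\<lambda>k z. (\<Prod>j<k. f j z) * (f k z - 1)"
    have "uniform_limit ?S (\<lambda>n z. \<Sum>k<n. ?g k z) (\<lambda>z. suminf (\<lambda>k. ?g k z)) sequentially"
    proof (rule Weierstrass_m_test)
      fix k z assume z: "z \<in> ?S"
      have "cmod (f k z - 1) * \<delta> \<le> cmod (f k z - 1) * cmod (1 - z)"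
        using z by (intro mult_left_mono) auto
      also have "\<dots> \<le> C * (1/2)^k" using C[of z k] z by simp
      finally have "cmod (f k z - 1) \<le> C / \<delta> * (1/2)^k" using d by (simp add: field_simps)
      thus "norm (?g k z) \<le> M * (C / \<delta> * (1/2)^k)"
        unfolding norm_mult using M[of z k] z M0 by (intro mult_mono) auto
    next
      show "summable (\<lambda>k. M * (C / \<delta> * (1/2)^k))"
        by (intro summable_mult summable_geometric) auto
    qed
    hence "uniform_limit ?S (\<lambda>n z. 1 + (\<Sum>k<n. ?g k z)) (\<lambda>z. 1 + suminf (\<lambda>k. ?g k z)) sequentially"
      by (intro uniform_limit_intros)
    moreover have "1 + (\<Sum>k<n. ?g k z) = (\<Prod>k<n. f k z)" for n z
      by (induction n) (auto simp: algebra_simps)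
    ultimately have u: "uniform_limit ?S (\<lambda>n z. \<Prod>k<n. f k z) (\<lambda>z. 1 + suminf (\<lambda>k. ?g k z)) sequentially"
      by simp
    moreover have "1 + suminf (\<lambda>k. ?g k z) = F z" if "z \<in> ?S" for z
      using tendsto_uniform_limitI[OF u that] unfolding F_def by (simp add: limI)
    ultimately show ?thesis by (subst uniform_limit_cong'[where g = "\<lambda>n z. \<Prod>k<n. f k z"]) auto
  qed
  have contP: "continuous_on (cball 0 1) (\<lambda>z. \<Prod>k<n. f k z)" for n
    by (intro continuous_intros cont)
  show "(\<lambda>n. \<Prod>k<n. f k z) \<longlonglongrightarrow> F z" if "cmod z \<le> 1" "z \<noteq> 1" for z
    using that by (intro tendsto_uniform_limitI[OF ul[of "cmod (1 - z)"]]) auto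
  show "continuous_on (cball 0 1 - {1}) F"
    unfolding continuous_on_eq_continuous_within
  proof
    fix x :: complex assume x: "x \<in> cball 0 1 - {1}"
    define \<delta> where "\<delta> = cmod (1 - x) / 2"
    have d: "\<delta> > 0" "\<delta> < cmod (1 - x)" using x by (auto simp: \<delta>_def)
    let ?U = "{z. \<delta> < cmod (1 - z)}"
    have oU: "open ?U" by (intro open_Collect_less continuous_intros)
    have "continuous_on {z. cmod z \<le> 1 \<and> \<delta> \<le> cmod (1 - z)} F"
      by (rule uniform_limit_theorem[OF _ ul[OF d(1)]])
        (auto intro!: always_eventually continuous_on_subset[OF contP])
    hence "continuous_on ((cball 0 1 - {1}) \<inter> ?U) F"
      by (rule continuous_on_subset) auto
    hence "continuous (at x within ((cball 0 1 - {1}) \<inter> ?U)) F"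
      using x d unfolding continuous_on_eq_continuous_within by auto
    thus "continuous (at x within (cball 0 1 - {1})) F"
      using at_within_nhd[OF _ oU, of x "(cball 0 1 - {1}) \<inter> ?U" "cball 0 1 - {1}"] d by auto
  qed
  show "F holomorphic_on ball 0 1"
  proof (rule holomorphic_uniform_sequence[where f = "\<lambda>n z. \<Prod>k<n. f k z"])
    show "open (ball 0 1 :: complex set)" by simp
    show "(\<lambda>z. \<Prod>k<n. f k z) holomorphic_on ball 0 1" for n
      by (intro holomorphic_intros hol)
    fix x :: complex assume x: "x \<in> ball 0 1"
    define d where "d = (1 - cmod x) / 2"
    have d: "d > 0" "cmod x + d = 1 - d" using x by (auto simp: d_def field_simps)
    have b: "cmod z \<le> 1 - d" if "z \<in> cball x d" for z
      using that norm_triangle_ineq2[of z x] d by (auto simp: dist_norm norm_minus_commute)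
    have "d \<le> cmod (1 - z)" if "z \<in> cball x d" for z
      using norm_triangle_ineq2[of 1 z] b[OF that] by simp
    moreover have "cmod z \<le> 1" "cmod z < 1" if "z \<in> cball x d" for z using b[OF that] d(1) by auto
    ultimately have sub: "cball x d \<subseteq> {z. cmod z \<le> 1 \<and> d \<le> cmod (1 - z)}" "cball x d \<subseteq> ball 0 1"
      by (auto simp del: mem_cball)
    show "\<exists>d. 0 < d \<and> cball x d \<subseteq> ball 0 1 \<and> uniform_limit (cball x d) (\<lambda>n z. \<Prod>k<n. f k z) F sequentially"
      using d sub uniform_limit_on_subset[OF ul[OF d(1)] sub(1)] by blast
  qed
qed

lemma blaschke_prod_norm_le:
  assumes "a \<in> {0..1/2}" "cmod z \<le> 1"
  shows "cmod (\<Prod>k<n. blaschke_factor a k z) \<le> 1"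
  unfolding prod_norm[symmetric] using blaschke_factor_norm_le[OF assms] by (intro prod_le_1) auto

lemma
  assumes a: "a \<in> {0..1/2}"
  shows blaschke_tendsto: "cmod z \<le> 1 \<Longrightarrow> z \<noteq> 1 \<Longrightarrow> (\<lambda>n. \<Prod>k<n. blaschke_factor a k z) \<longlonglongrightarrow> blaschke a z"
    and blaschke_continuous: "continuous_on (cball 0 1 - {1}) (blaschke a)"
    and blaschke_holomorphic: "blaschke a holomorphic_on ball 0 1"
proof -
  have hol: "blaschke_factor a k holomorphic_on ball 0 1" for k
    using blaschke_factor_holomorphic[OF a] by (rule holomorphic_on_subset) auto
  note * = product_limit_disc[of "blaschke_factor a", OF blaschke_prod_norm_le[OF a] blaschke_factor_near_one[OF a]
    holomorphic_on_imp_continuous_on[OF blaschke_factor_holomorphic[OF a]] hol]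
  show "cmod z \<le> 1 \<Longrightarrow> z \<noteq> 1 \<Longrightarrow> (\<lambda>n. \<Prod>k<n. blaschke_factor a k z) \<longlonglongrightarrow> blaschke a z"
    unfolding blaschke_def by (rule *(1))
  show "continuous_on (cball 0 1 - {1}) (blaschke a)"
    using *(2) unfolding blaschke_def[abs_def] .
  show "blaschke a holomorphic_on ball 0 1"
    using *(3) unfolding blaschke_def[abs_def] .
qed

lemma blaschke_norm_le:
  assumes "a \<in> {0..1/2}" "cmod z \<le> 1" "z \<noteq> 1"
  shows "cmod (blaschke a z) \<le> 1"
  by (rule Lim_bounded[OF tendsto_norm[OF blaschke_tendsto[OF assms]], of 0]) (use blaschke_prod_norm_le[OF assms(1,2)] in auto)

lemma blaschke_norm_circle:
  assumes "a \<in> {0..1/2}" "cmod z = 1" "z \<noteq> 1"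
  shows "cmod (blaschke a z) = 1"
proof -
  have "(\<lambda>n. cmod (\<Prod>k<n. blaschke_factor a k z)) \<longlonglongrightarrow> cmod (blaschke a z)"
    using assms by (intro tendsto_norm blaschke_tendsto) auto
  moreover have "cmod (\<Prod>k<n. blaschke_factor a k z) = 1" for n
    unfolding prod_norm[symmetric] using blaschke_factor_norm_circle[OF assms(1,2)] by simp
  ultimately show ?thesis by (simp add: LIMSEQ_const_iff)
qed

lemma blaschke_inner:
  assumes a: "a \<in> {0..1/2}"
  shows "inner_function (blaschke a)"
  unfolding inner_function_def
proof (intro conjI)
  show "blaschke a holomorphic_on ball 0 1" by (rule blaschke_holomorphic[OF a])
  show "bounded (blaschke a ` ball 0 1)"
    by (intro boundedI[of _ 1]) (force intro!: blaschke_norm_le[OF a])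
  have lim: "\<exists>l. ((\<lambda>r. blaschke a (complex_of_real r * cis t)) \<longlongrightarrow> l) (at_left 1) \<and> cmod l = 1"
    if t: "t \<in> {0<..<2 * pi}" for t
  proof (intro exI conjI)
    have ne: "cis t \<noteq> 1"
    proof
      assume "cis t = 1"
      hence "cos t = 1" by (simp add: complex_eq_iff)
      then obtain n :: int where n: "t = n * 2 * pi" by (auto simp: cos_one_2pi_int)
      with t have "0 < real_of_int n * (2 * pi)" "real_of_int n * (2 * pi) < 1 * (2 * pi)" by auto
      hence "0 < n" "n < 1" by (auto simp: zero_less_mult_iff)
      thus False by simp
    qed
    show "cmod (blaschke a (cis t)) = 1" using blaschke_norm_circle[OF a _ ne] by simp
    have "((\<lambda>r. complex_of_real r * cis t) \<longlongrightarrow> of_real 1 * cis t) (at_left 1)"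
      by (intro tendsto_intros)
    moreover have "eventually (\<lambda>r::real. r \<in> {0<..<1}) (at_left 1)"
      by (rule eventually_at_left_real) simp
    hence "eventually (\<lambda>r. complex_of_real r * cis t \<in> cball 0 1 - {1}) (at_left 1)"
    proof eventually_elim
      case (elim r)
      hence "cmod (complex_of_real r * cis t) < 1" by (simp add: norm_mult)
      thus ?case by (auto simp del: norm_mult)
    qed
    ultimately show "((\<lambda>r. blaschke a (complex_of_real r * cis t)) \<longlongrightarrow> blaschke a (cis t)) (at_left 1)"
      using continuous_on_tendsto_compose[OF blaschke_continuous[OF a], of "\<lambda>r. complex_of_real r * cis t" "cis t" "at_left 1"] ne
      by simp
  qed
  show "AE t in lebesgue_on {0..2 * pi}.
      \<exists>l. ((\<lambda>r. blaschke a (complex_of_real r * cis t)) \<longlongrightarrow> l) (at_left 1) \<and> cmod l = 1"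
  proof (rule AE_I')
    show "{0, 2 * pi} \<in> null_sets (lebesgue_on {0..2 * pi})"
      by (subst null_sets_restrict_space) (auto simp: negligible_iff_null_sets[symmetric])
    show "{t \<in> space (lebesgue_on {0..2 * pi}). \<not> (\<exists>l. ((\<lambda>r. blaschke a (complex_of_real r * cis t)) \<longlongrightarrow> l) (at_left 1) \<and> cmod l = 1)}
      \<subseteq> {0, 2 * pi}"
      using lim by (force simp: less_le)
  qed
qed

text \<open>The zero of the first factor, mapped back to the disc.\<close>

lemma blaschke_zero:
  assumes "a \<in> {0..1/2}"
  obtains z where "z \<in> ball 0 1" "blaschke a z = 0"
proof -
  define c where "c = half_plane_zero a 0"
  define z where "z = (1 - c) / (1 + c)"
  have Re: "Re c > 0" using angle_bounds[OF assms] by (simp add: c_def Re_half_plane_zero)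
  hence nz: "1 + c \<noteq> 0" by (auto simp: complex_eq_iff)
  have "(cmod (1 - c))\<^sup>2 < (cmod (1 + c))\<^sup>2"
    using Re unfolding cmod_power2 by (simp add: power2_eq_square algebra_simps)
  hence "cmod (1 - c) < cmod (1 + c)" by (rule power2_less_imp_less) auto
  hence z: "z \<in> ball 0 1" using nz by (simp add: z_def norm_divide)
  have "factor_num a 0 z = 0"
    unfolding factor_num_def c_def[symmetric] z_def using nz by (simp add: field_simps)
  hence "blaschke_factor a 0 z = 0" by (simp add: blaschke_factor_def)
  hence "(\<Prod>k<n. blaschke_factor a k z) = 0" if "n \<ge> 1" for n using that by (intro prod_zero) auto
  hence "(\<lambda>n. \<Prod>k<n. blaschke_factor a k z) \<longlonglongrightarrow> 0"
    by (intro tendsto_eventually eventually_sequentiallyI[of 1])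
  moreover have "(\<lambda>n. \<Prod>k<n. blaschke_factor a k z) \<longlonglongrightarrow> blaschke a z"
    using z by (intro blaschke_tendsto assms) auto
  ultimately show ?thesis using that z LIMSEQ_unique by blast
qed

section \<open>Approximate divisibility within the family\<close>

text \<open>The left side is small unless \<open>A\<close> and \<open>Y\<close> are comparable; it is dominated by a multiple of the
  difference, over one dyadic step, of a monotone function of \<open>Y\<close> with values in the unit
  interval. Hence its sum over all dyadic scales is bounded, see \<open>dyadic_sum_bound\<close>.\<close>

lemma telescoping_bound:
  fixes A Y :: real
  assumes "0 \<le> A" "0 \<le> Y"
  shows "A * Y / (A\<^sup>2 + Y\<^sup>2) \<le> 7/2 * (Y / (Y + A) - (Y/2) / (Y/2 + A))"
proof (cases "A = 0 \<or> Y = 0")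
  case True thus ?thesis using assms by auto
next
  case False
  hence p: "A > 0" "Y > 0" using assms by auto
  have "Y / (Y + A) - (Y/2) / (Y/2 + A) = A * Y / ((Y + A) * (Y + 2 * A))"
    using p by (simp add: field_simps)
  moreover have "A * Y / (A\<^sup>2 + Y\<^sup>2) \<le> 7/2 * (A * Y / ((Y + A) * (Y + 2 * A)))"
  proof -
    have "(Y + A) * (Y + 2 * A) \<le> 7/2 * (A\<^sup>2 + Y\<^sup>2)"
    proof -
      \<comment> \<open>Expanding the product leaves \<open>Y\<^sup>2 + 3 A Y + 2 A\<^sup>2\<close>; the mixed term costs \<open>3 / 2\<close> of both squares.\<close>
      have "3 * (2 * A * Y) \<le> 3 * (A\<^sup>2 + Y\<^sup>2)"
        by (intro mult_left_mono sum_squares_bound) auto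
      also have "\<dots> \<le> 3 * (A\<^sup>2 + Y\<^sup>2) + 2 * Y\<^sup>2" by simp
      finally show ?thesis by (simp add: power2_eq_square algebra_simps)
    qed
    moreover have "0 < A\<^sup>2 + Y\<^sup>2" "0 < (Y + A) * (Y + 2 * A)" using p by (auto intro: add_pos_pos)
    ultimately have "1 / (A\<^sup>2 + Y\<^sup>2) \<le> 7/2 * (1 / ((Y + A) * (Y + 2 * A)))"
      by (simp add: field_simps)
    from mult_left_mono[OF this, of "A * Y"] p show ?thesis by simp
  qed
  ultimately show ?thesis by simp
qed

lemma dyadic_sum_bound:
  fixes A B :: real
  assumes "0 \<le> A" "0 \<le> B"
  shows "(\<Sum>k<n. A * ((1/2)^k * B) / (A\<^sup>2 + ((1/2)^k * B)\<^sup>2)) \<le> 7/2"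
proof -
  define G where "G k = ((1/2)^k * B) / ((1/2)^k * B + A)" for k :: nat
  have "(\<Sum>k<n. A * ((1/2)^k * B) / (A\<^sup>2 + ((1/2)^k * B)\<^sup>2)) \<le> (\<Sum>k<n. 7/2 * (G k - G (Suc k)))"
  proof (rule sum_mono)
    fix k
    show "A * ((1/2)^k * B) / (A\<^sup>2 + ((1/2)^k * B)\<^sup>2) \<le> 7/2 * (G k - G (Suc k))"
      using telescoping_bound[OF assms(1), of "(1/2)^k * B"] assms(2) by (simp add: G_def)
  qed
  also have "\<dots> = 7/2 * (G 0 - G n)"
    unfolding sum_distrib_left[symmetric] sum_lessThan_telescope' ..
  also have "\<dots> \<le> 7/2 * (1 - 0)"
    using assms by (intro mult_left_mono diff_mono) (auto simp: G_def divide_le_eq_1)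
  finally show ?thesis by simp
qed

lemma prod_minus_one_bound:
  fixes x :: "nat \<Rightarrow> real"
  assumes "(\<Sum>k<n. \<bar>x k - 1\<bar>) \<le> X"
  shows "\<bar>(\<Prod>k<n. x k) - 1\<bar> \<le> exp X - 1"
proof -
  have "\<bar>(\<Prod>k<n. x k) - 1\<bar> \<le> (\<Prod>k<n. 1 + \<bar>x k - 1\<bar>) - 1"
    using norm_prod_minus1_le_prod_minus1[of "\<lambda>k. x k - 1" "{..<n}"] by simp
  also have "(\<Prod>k<n. 1 + \<bar>x k - 1\<bar>) \<le> exp (\<Sum>k<n. \<bar>x k - 1\<bar>)"
    unfolding exp_sum[OF finite_lessThan] by (intro prod_mono) (auto simp: exp_ge_add_one_self)
  also have "\<dots> \<le> exp X" using assms by simp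
  finally show ?thesis by simp
qed

lemma abs_sin_diff_le: "\<bar>sin x - sin y\<bar> \<le> \<bar>x - y :: real\<bar>"
proof -
  have "\<bar>sin x - sin y\<bar> = 2 * \<bar>sin ((x - y) / 2)\<bar> * \<bar>cos ((x + y) / 2)\<bar>"
    by (simp add: sin_diff_sin abs_mult)
  also have "\<dots> \<le> 2 * \<bar>(x - y) / 2\<bar> * 1"
    by (intro mult_mono abs_sin_x_le_abs_x) auto
  finally show ?thesis by simp
qed

text \<open>On the circle only the mixed term of \<open>norm_factor_den_sq\<close> depends on the angle. It contributes
  \<open>A\<close> times \<open>2\<^sup>-\<^sup>k B\<close>, compared with the sum of their squares: the quantity controlled by
  \<open>dyadic_sum_bound\<close>.\<close>

lemma norm_outer_factor_circle:
  assumes "s \<in> {0..1/2}" "cmod z = 1"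
  defines "A \<equiv> cmod (1 - z)" and "B \<equiv> cmod (1 + z)"
  shows "\<bar>cmod (outer_factor s a k z) - 1\<bar> \<le> 4 * \<bar>a - s\<bar> * (A * ((1/2) ^ k * B) / (A\<^sup>2 + ((1/2) ^ k * B)\<^sup>2))"
proof -
  let ?Y = "(1/2) ^ k * B" and ?D = "(cmod (factor_den s k z))\<^sup>2"
  have D: "0 < ?D" using factor_den_nz[of s z k] assms by simp
  have L: "(A\<^sup>2 + ?Y\<^sup>2) / 2 \<le> ?D" using factor_den_lower[of s z k] assms by simp
  have "A \<noteq> 0 \<or> B \<noteq> 0" unfolding A_def B_def by (auto simp: add_eq_0_iff)
  hence P: "0 < A\<^sup>2 + ?Y\<^sup>2" by (auto simp: sum_power2_gt_zero_iff)
  have "cmod (outer_factor s a k z) - 1 = ((cmod (factor_den a k z))\<^sup>2 - ?D) / ?D"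
    using D by (simp add: outer_factor_def norm_power norm_divide power_divide diff_divide_distrib)
  also have "(cmod (factor_den a k z))\<^sup>2 - ?D = 2 * (1/2) ^ k * (2 * Im z) * (sin a - sin s)"
    unfolding norm_factor_den_sq using assms(2) by (simp add: algebra_simps)
  finally have "\<bar>cmod (outer_factor s a k z) - 1\<bar> = 2 * (1/2) ^ k * (2 * \<bar>Im z\<bar>) * \<bar>sin a - sin s\<bar> / ?D"
    by (simp add: abs_mult)
  also have "\<dots> \<le> 2 * (1/2) ^ k * (A * B) * \<bar>a - s\<bar> / ((A\<^sup>2 + ?Y\<^sup>2) / 2)"
  proof (rule frac_le)
    have "2 * \<bar>Im z\<bar> \<le> A * B" using abs_Im_le[of z] assms by simp
    thus "2 * (1/2) ^ k * (2 * \<bar>Im z\<bar>) * \<bar>sin a - sin s\<bar> \<le> 2 * (1/2) ^ k * (A * B) * \<bar>a - s\<bar>"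
      by (intro mult_mono[OF mult_left_mono] abs_sin_diff_le) (auto simp: A_def B_def)
  qed (use L P in \<open>auto simp: A_def B_def\<close>)
  also have "\<dots> = 4 * \<bar>a - s\<bar> * (A * ?Y / (A\<^sup>2 + ?Y\<^sup>2))" by (simp add: mult_ac)
  finally show ?thesis .
qed

lemma outer_prod_circle:
  assumes "s \<in> {0..1/2}" "cmod z = 1"
  shows "\<bar>cmod (\<Prod>k<n. outer_factor s a k z) - 1\<bar> \<le> exp (14 * \<bar>a - s\<bar>) - 1"
proof -
  have "(\<Sum>k<n. \<bar>cmod (outer_factor s a k z) - 1\<bar>) \<le>
      (\<Sum>k<n. 4 * \<bar>a - s\<bar> * (cmod (1 - z) * ((1/2) ^ k * cmod (1 + z)) / ((cmod (1 - z))\<^sup>2 + ((1/2) ^ k * cmod (1 + z))\<^sup>2)))"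
    by (intro sum_mono norm_outer_factor_circle assms)
  also have "\<dots> \<le> 4 * \<bar>a - s\<bar> * (7/2)"
    unfolding sum_distrib_left[symmetric] by (intro mult_left_mono dyadic_sum_bound) auto
  finally have "(\<Sum>k<n. \<bar>cmod (outer_factor s a k z) - 1\<bar>) \<le> 14 * \<bar>a - s\<bar>" by simp
  from prod_minus_one_bound[OF this] show ?thesis by (simp add: prod_norm)
qed

lemma disc_maximum_modulus:
  assumes "f holomorphic_on cball 0 1" "\<And>z. cmod z = 1 \<Longrightarrow> cmod (f z) \<le> B" "cmod z \<le> 1"
  shows "cmod (f z) \<le> B"
proof (rule maximum_modulus_frontier[of f "cball 0 1"])
  show "f holomorphic_on interior (cball 0 1)"
    using assms(1) holomorphic_on_subset interior_subset by blast
  show "continuous_on (closure (cball 0 1)) f"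
    using assms(1) by (simp add: holomorphic_on_imp_continuous_on)
qed (use assms in auto)

text \<open>The factors on both sides are \<open>- z cnj D / D\<close> for their denominators \<open>D\<close>, so their quotient is
  \<open>q\<^sup>2 / \<bar>q\<bar>\<^sup>2\<close> for the quotient \<open>q\<close> of the denominators.\<close>

lemma blaschke_times_outer_circle:
  assumes "a \<in> {0..1/2}" "s \<in> {0..1/2}" "cmod z = 1"
  shows "blaschke_factor a k z * outer_factor s a k z = blaschke_factor s k z * of_real (cmod (outer_factor s a k z))"
proof -
  have nz: "factor_den a k z \<noteq> 0" "factor_den s k z \<noteq> 0" using factor_den_nz assms by auto
  have "complex_of_real (cmod (outer_factor s a k z))
      = (factor_den a k z * cnj (factor_den a k z)) / (factor_den s k z * cnj (factor_den s k z))"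
    unfolding outer_factor_def norm_power norm_divide power_divide of_real_divide complex_norm_square ..
  thus ?thesis
    using nz unfolding blaschke_factor_def factor_num_circle[OF assms(3)] outer_factor_def
    by (simp add: field_simps power2_eq_square)
qed

text \<open>By the maximum principle it suffices to look at the circle. There the difference equals, up to a
  unimodular factor, \<open>1 - \<bar>h\<bar>\<close>, where \<open>h\<close> is the product of the outer factors.\<close>

lemma finite_blaschke_approx:
  assumes "a \<in> {0..1/2}" "s \<in> {0..1/2}" "cmod z \<le> 1"
  shows "cmod ((\<Prod>k<n. blaschke_factor s k z) - (\<Prod>k<n. blaschke_factor a k z) * (\<Prod>k<n. outer_factor s a k z))
    \<le> exp (14 * \<bar>a - s\<bar>) - 1"
proof (rule disc_maximum_modulus[OF _ _ assms(3)])
  show "(\<lambda>z. (\<Prod>k<n. blaschke_factor s k z) - (\<Prod>k<n. blaschke_factor a k z) * (\<Prod>k<n. outer_factor s a k z)) holomorphic_on cball 0 1"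
    using assms by (intro holomorphic_intros blaschke_factor_holomorphic outer_factor_holomorphic)
  fix z :: complex assume z: "cmod z = 1"
  have "(\<Prod>k<n. blaschke_factor a k z) * (\<Prod>k<n. outer_factor s a k z)
      = (\<Prod>k<n. blaschke_factor s k z) * of_real (cmod (\<Prod>k<n. outer_factor s a k z))"
    unfolding prod.distrib[symmetric] prod_norm[symmetric] of_real_prod
    by (simp add: blaschke_times_outer_circle[OF assms(1,2) z])
  hence "(\<Prod>k<n. blaschke_factor s k z) - (\<Prod>k<n. blaschke_factor a k z) * (\<Prod>k<n. outer_factor s a k z)
      = (\<Prod>k<n. blaschke_factor s k z) * of_real (1 - cmod (\<Prod>k<n. outer_factor s a k z))"
    by (simp add: algebra_simps)
  also have "cmod \<dots> = \<bar>cmod (\<Prod>k<n. outer_factor s a k z) - 1\<bar>"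
    unfolding norm_mult norm_of_real prod_norm[symmetric] using blaschke_factor_norm_circle[OF assms(2) z]
    by (simp add: prod_norm)
  finally show "cmod ((\<Prod>k<n. blaschke_factor s k z) - (\<Prod>k<n. blaschke_factor a k z) * (\<Prod>k<n. outer_factor s a k z)) \<le> exp (14 * \<bar>a - s\<bar>) - 1"
    using outer_prod_circle[OF assms(2) z, of a n] by simp
qed

lemma outer_prod_bound:
  assumes "s \<in> {0..1/2}" "cmod z \<le> 1"
  shows "cmod (\<Prod>k<n. outer_factor s a k z) \<le> exp (14 * \<bar>a - s\<bar>)"
proof (rule disc_maximum_modulus[OF _ _ assms(2)])
  show "(\<lambda>z. \<Prod>k<n. outer_factor s a k z) holomorphic_on cball 0 1"
    using assms by (intro holomorphic_intros outer_factor_holomorphic)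
  show "cmod (\<Prod>k<n. outer_factor s a k z) \<le> exp (14 * \<bar>a - s\<bar>)" if "cmod z = 1" for z
    using outer_prod_circle[OF assms(1) that, of a n] by linarith
qed

text \<open>The limit of \<open>finite_blaschke_approx\<close>; finite products come first because they extend continuously to
  the whole closed disc, where the maximum principle applies directly.\<close>

lemma blaschke_approx:
  assumes "a \<in> {0..1/2}" "s \<in> {0..1/2}"
  obtains h where "h holomorphic_on ball 0 1" "bounded (h ` ball 0 1)"
    "\<And>z. z \<in> ball 0 1 \<Longrightarrow> cmod (blaschke s z - blaschke a z * h z) \<le> exp (14 * \<bar>a - s\<bar>) - 1"
proof -
  define h where "h z = lim (\<lambda>n. \<Prod>k<n. outer_factor s a k z)" for z
  have hol: "outer_factor s a k holomorphic_on ball 0 1" for k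
    using outer_factor_holomorphic[OF assms(2)] by (rule holomorphic_on_subset) auto
  note * = product_limit_disc[of "outer_factor s a", OF outer_prod_bound[OF assms(2)] outer_factor_near_one[OF assms(2)]
    holomorphic_on_imp_continuous_on[OF outer_factor_holomorphic[OF assms(2)]] hol]
  have lim: "(\<lambda>n. \<Prod>k<n. outer_factor s a k z) \<longlonglongrightarrow> h z" if "z \<in> ball 0 1" for z
    unfolding h_def by (rule *(1)) (use that in auto)
  show thesis
  proof
    show "h holomorphic_on ball 0 1" using *(3) unfolding h_def[abs_def] .
    show "bounded (h ` ball 0 1)"
    proof (rule boundedI, clarify)
      fix z :: complex assume z: "z \<in> ball 0 1"
      show "cmod (h z) \<le> exp (14 * \<bar>a - s\<bar>)"
        by (rule Lim_bounded[OF tendsto_norm[OF lim[OF z]], of 0]) (use outer_prod_bound[OF assms(2)] z in auto)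
    qed
    fix z :: complex assume z: "z \<in> ball 0 1"
    have "(\<lambda>n. cmod ((\<Prod>k<n. blaschke_factor s k z) - (\<Prod>k<n. blaschke_factor a k z) * (\<Prod>k<n. outer_factor s a k z)))
      \<longlonglongrightarrow> cmod (blaschke s z - blaschke a z * h z)"
      using z by (intro tendsto_intros blaschke_tendsto assms lim) auto
    thus "cmod (blaschke s z - blaschke a z * h z) \<le> exp (14 * \<bar>a - s\<bar>) - 1"
      by (rule Lim_bounded[of _ _ 0]) (use finite_blaschke_approx[OF assms, of z] z in auto)
  qed
qed

section \<open>Phases at the accumulation point of the zeros\<close>

text \<open>The points \<open>\<zeta> = \<i> 2\<^sup>-\<^sup>n\<close> of the boundary, tending to the accumulation point of the zeros.\<close>

definition circle_pt :: "nat \<Rightarrow> complex"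
  where "circle_pt n = (1 - \<i> * (1/2) ^ n) / (1 + \<i> * (1/2) ^ n)"

lemma one_plus_i_pow_nz: "1 + \<i> * (1/2) ^ n \<noteq> (0 :: complex)"
proof -
  have "(1/2 :: complex) ^ n = of_real ((1/2) ^ n)" by simp
  hence "Im ((1/2 :: complex) ^ n) = 0" by (metis Im_complex_of_real)
  hence "Re (1 + \<i> * (1/2) ^ n) = 1" by simp
  thus ?thesis by (metis zero_complex.sel(1) zero_neq_one)
qed

lemma one_minus_circle_pt: "1 - circle_pt n = 2 * \<i> * (1/2) ^ n / (1 + \<i> * (1/2) ^ n)"
  and one_plus_circle_pt: "1 + circle_pt n = 2 / (1 + \<i> * (1/2) ^ n)"
proof -
  have "1 - (1 - w) / (1 + w) = 2 * w / (1 + w)" "1 + (1 - w) / (1 + w) = 2 / (1 + w)"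
    if "1 + w \<noteq> 0" for w :: complex
    using that by (simp_all add: field_simps)
  from this[OF one_plus_i_pow_nz[of n]]
  show "1 - circle_pt n = 2 * \<i> * (1/2) ^ n / (1 + \<i> * (1/2) ^ n)"
    "1 + circle_pt n = 2 / (1 + \<i> * (1/2) ^ n)"
    by (simp_all only: circle_pt_def mult.assoc)
qed

lemma circle_pt_ne_1: "circle_pt n \<noteq> 1"
  using one_minus_circle_pt[of n] one_plus_i_pow_nz[of n] by auto

lemma norm_circle_pt: "cmod (circle_pt n) = 1"
proof -
  have "cnj (1 + \<i> * (1/2) ^ n) = 1 - \<i> * (1/2) ^ n" by simp
  hence "cmod (1 - \<i> * (1/2) ^ n) = cmod (1 + \<i> * (1/2) ^ n)" by (metis complex_mod_cnj)
  thus ?thesis using one_plus_i_pow_nz[of n] by (simp add: circle_pt_def norm_divide)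
qed

lemma blaschke_factor_circle_pt:
  "blaschke_factor a k (circle_pt n) = (\<i> * (1/2) ^ n - half_plane_zero a k) / (\<i> * (1/2) ^ n + cnj (half_plane_zero a k))"
proof -
  let ?w = "1 + \<i> * (1/2) ^ n :: complex"
  have "factor_num a k (circle_pt n) = (2 / ?w) * (\<i> * (1/2) ^ n - half_plane_zero a k)"
    unfolding factor_num_def one_minus_circle_pt one_plus_circle_pt by (simp add: diff_divide_distrib algebra_simps)
  moreover have "factor_den a k (circle_pt n) = (2 / ?w) * (\<i> * (1/2) ^ n + cnj (half_plane_zero a k))"
    unfolding factor_den_def one_minus_circle_pt one_plus_circle_pt by (simp add: add_divide_distrib algebra_simps)
  ultimately show ?thesis
    unfolding blaschke_factor_def using one_plus_i_pow_nz[of n]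
    by (simp only: mult_divide_mult_cancel_left divide_eq_0_iff zero_neq_numeral[symmetric] not_False_eq_True disj_not1 simp_thms)
qed

text \<open>Halving both \<open>\<zeta>\<close> and the zero leaves a factor unchanged.\<close>

lemma blaschke_factor_circle_pt_Suc:
  "blaschke_factor a (Suc k) (circle_pt (Suc n)) = blaschke_factor a k (circle_pt n)"
proof -
  have z: "half_plane_zero a (Suc k) = 1/2 * half_plane_zero a k" by (simp add: half_plane_zero_def)
  have "\<i> * (1/2) ^ Suc n - half_plane_zero a (Suc k) = 1/2 * (\<i> * (1/2) ^ n - half_plane_zero a k)"
    "\<i> * (1/2) ^ Suc n + cnj (half_plane_zero a (Suc k)) = 1/2 * (\<i> * (1/2) ^ n + cnj (half_plane_zero a k))"
    unfolding z by (simp_all add: algebra_simps)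
  hence "blaschke_factor a (Suc k) (circle_pt (Suc n)) =
    (1/2 * (\<i> * (1/2) ^ n - half_plane_zero a k)) / (1/2 * (\<i> * (1/2) ^ n + cnj (half_plane_zero a k)))"
    unfolding blaschke_factor_circle_pt by (simp only:)
  also have "\<dots> = blaschke_factor a k (circle_pt n)"
    unfolding blaschke_factor_circle_pt by (rule mult_divide_mult_cancel_left) simp
  finally show ?thesis .
qed

text \<open>The self-similarity of the zeros: one dyadic step shifts the product by one index and leaves the
  first factor over.\<close>

lemma blaschke_circle_pt_Suc:
  assumes "a \<in> {0..1/2}"
  shows "blaschke a (circle_pt (Suc n)) = blaschke_factor a 0 (circle_pt (Suc n)) * blaschke a (circle_pt n)"
proof -
  have L: "(\<lambda>N. \<Prod>k<N. blaschke_factor a k (circle_pt n)) \<longlonglongrightarrow> blaschke a (circle_pt n)" for n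
    by (intro blaschke_tendsto assms circle_pt_ne_1) (simp add: norm_circle_pt)
  have "(\<Prod>k<Suc N. blaschke_factor a k (circle_pt (Suc n)))
      = blaschke_factor a 0 (circle_pt (Suc n)) * (\<Prod>k<N. blaschke_factor a k (circle_pt n))" for N
    by (simp only: prod.lessThan_Suc_shift blaschke_factor_circle_pt_Suc)
  moreover have "(\<lambda>N. \<Prod>k<Suc N. blaschke_factor a k (circle_pt (Suc n))) \<longlonglongrightarrow> blaschke a (circle_pt (Suc n))"
    using L[of "Suc n"] by (rule LIMSEQ_Suc)
  ultimately have "(\<lambda>N. blaschke_factor a 0 (circle_pt (Suc n)) * (\<Prod>k<N. blaschke_factor a k (circle_pt n)))
      \<longlonglongrightarrow> blaschke a (circle_pt (Suc n))" by simp
  thus ?thesis by (rule LIMSEQ_unique) (intro tendsto_mult_left L)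
qed

lemma blaschke_factor_0_circle_pt_tendsto: "(\<lambda>n. blaschke_factor a 0 (circle_pt n)) \<longlonglongrightarrow> - cis (2 * a)"
proof -
  have "(\<lambda>n. (\<i> * (1/2) ^ n - half_plane_zero a 0) / (\<i> * (1/2) ^ n + cnj (half_plane_zero a 0)))
    \<longlonglongrightarrow> (\<i> * 0 - half_plane_zero a 0) / (\<i> * 0 + cnj (half_plane_zero a 0))"
    by (intro tendsto_intros LIMSEQ_power_zero) (auto simp: half_plane_zero_def norm_divide)
  moreover have "(\<i> * 0 - half_plane_zero a 0) / (\<i> * 0 + cnj (half_plane_zero a 0)) = - cis (2 * a)"
    by (simp add: half_plane_zero_def cis_cnj cis_divide)
  ultimately show ?thesis unfolding blaschke_factor_circle_pt by simp
qed

text \<open>The quotient of the two Blaschke products at \<open>circle_pt n\<close> is multiplied at each step by a factor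
  tending to \<open>cis (2 a)\<close>, hence changes sign, approximately, in \<open>m\<close> steps. A number and its
  negative cannot both be near \<open>d / c\<close>.\<close>

lemma blaschke_far:
  assumes a: "a \<in> {0..1/2}" and m: "real m * (2 * a) = pi"
    and c: "cmod c = 1" "cmod d = 1"
    and close: "\<And>z. cmod z = 1 \<Longrightarrow> z \<noteq> 1 \<Longrightarrow> cmod (c * blaschke a z - d * blaschke 0 z) \<le> \<epsilon>"
  shows "1 \<le> \<epsilon>"
proof -
  define \<rho> where "\<rho> n = blaschke a (circle_pt n) / blaschke 0 (circle_pt n)" for n
  define g where "g n = blaschke_factor a 0 (circle_pt (Suc n)) / blaschke_factor 0 0 (circle_pt (Suc n))" for n
  have n1: "cmod (blaschke b (circle_pt n)) = 1" if "b \<in> {0..1/2}" for b n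
    using that by (intro blaschke_norm_circle norm_circle_pt circle_pt_ne_1)
  have nz: "blaschke b (circle_pt n) \<noteq> 0" if "b \<in> {0..1/2}" for b n
    using n1[OF that, of n] by auto
  have \<rho>1: "cmod (\<rho> n) = 1" for n using n1[OF a] n1[of 0] by (simp add: \<rho>_def norm_divide)
  have step: "\<rho> (Suc n) = g n * \<rho> n" for n
    using blaschke_circle_pt_Suc[OF a, of n] blaschke_circle_pt_Suc[of 0 n]
    by (simp add: \<rho>_def g_def)
  have iter: "\<rho> (n + j) = (\<Prod>i<j. g (n + i)) * \<rho> n" for n j
    by (induction j) (auto simp: step)
  have "g \<longlonglongrightarrow> - cis (2 * a) / - cis (2 * 0)"
    unfolding g_def
    by (intro tendsto_divide LIMSEQ_Suc blaschke_factor_0_circle_pt_tendsto) auto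
  hence g: "g \<longlonglongrightarrow> cis (2 * a)" by simp
  have "(\<lambda>n. \<Prod>i<m. g (n + i)) \<longlonglongrightarrow> (\<Prod>i<m. cis (2 * a))"
    by (intro tendsto_prod LIMSEQ_ignore_initial_segment g)
  also have "(\<Prod>i<m. cis (2 * a)) = -1"
    using m by (simp add: Complex.DeMoivre)
  finally have "(\<lambda>n. 2 * \<epsilon> + cmod (1 + (\<Prod>i<m. g (n + i)))) \<longlonglongrightarrow> 2 * \<epsilon> + cmod (1 + (-1))"
    by (intro tendsto_intros)
  moreover have "2 \<le> 2 * \<epsilon> + cmod (1 + (\<Prod>i<m. g (n + i)))" for n
  proof -
    have cl: "cmod (c * \<rho> n - d) \<le> \<epsilon>" for n
    proof -
      have "c * \<rho> n - d = (c * blaschke a (circle_pt n) - d * blaschke 0 (circle_pt n)) / blaschke 0 (circle_pt n)"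
        using nz[of 0 n] by (simp add: \<rho>_def field_simps)
      thus ?thesis
        using close[OF norm_circle_pt circle_pt_ne_1, of n] n1[of 0 n] by (simp add: norm_divide)
    qed
    \<comment> \<open>Both \<open>c \<rho> n\<close> and \<open>c \<rho> (n + m)\<close> are near \<open>d\<close>, while their sum is small for large \<open>n\<close>.\<close>
    have "2 * d = c * \<rho> n * (1 + (\<Prod>i<m. g (n + i))) - (c * \<rho> n - d) - (c * \<rho> (n + m) - d)"
      unfolding iter[of n m] by (simp add: algebra_simps)
    also have "cmod \<dots> \<le> cmod (c * \<rho> n * (1 + (\<Prod>i<m. g (n + i)))) + cmod (c * \<rho> n - d) + cmod (c * \<rho> (n + m) - d)"
      by (meson add_mono norm_triangle_ineq4 order_refl order_trans)
    also have "\<dots> \<le> cmod (1 + (\<Prod>i<m. g (n + i))) + \<epsilon> + \<epsilon>"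
      by (intro add_mono cl) (simp add: norm_mult c \<rho>1)
    finally show ?thesis using c by (simp add: norm_mult)
  qed
  ultimately have "2 \<le> 2 * \<epsilon> + cmod (1 + (-1))"
    by (intro LIMSEQ_le_const) auto
  thus ?thesis by simp
qed

section \<open>The path of projections\<close>

lemma range_proj_blaschke_dist:
  assumes "a \<in> {0..1/2}" "s \<in> {0..1/2}"
  shows "norm (range_proj (blaschke a) - range_proj (blaschke s)) \<le> 2 * (exp (14 * \<bar>a - s\<bar>) - 1)"
proof (rule norm_projection_diff_le)
  have *: "norm (blinfun_apply (range_proj (blaschke s)) f
      - blinfun_apply (range_proj (blaschke a)) (blinfun_apply (range_proj (blaschke s)) f))
      \<le> (exp (14 * \<bar>a - s\<bar>) - 1) * norm f" if as: "a \<in> {0..1/2}" "s \<in> {0..1/2}" for a s f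
  proof -
    obtain h where h: "h holomorphic_on ball 0 1" "bounded (h ` ball 0 1)"
      "\<And>z. z \<in> ball 0 1 \<Longrightarrow> cmod (blaschke s z - blaschke a z * h z) \<le> exp (14 * \<bar>a - s\<bar>) - 1"
      using blaschke_approx[OF as] by blast
    show ?thesis
      by (rule range_proj_approx[OF blaschke_inner[OF as(2)] blaschke_inner[OF as(1)] _ h(3)])
        (use h in \<open>auto simp: bounded_holomorphic_def\<close>)
  qed
  show "norm (blinfun_apply (range_proj (blaschke s)) f
      - blinfun_apply (range_proj (blaschke a)) (blinfun_apply (range_proj (blaschke s)) f))
      \<le> (exp (14 * \<bar>a - s\<bar>) - 1) * norm f" for f by (rule *[OF assms])
  show "norm (blinfun_apply (range_proj (blaschke a)) f
      - blinfun_apply (range_proj (blaschke s)) (blinfun_apply (range_proj (blaschke a)) f))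
      \<le> (exp (14 * \<bar>a - s\<bar>) - 1) * norm f" for f
    using *[OF assms(2,1), of f] by (simp add: abs_minus_commute)
qed (auto intro!: range_proj_orthogonal blaschke_inner assms)

lemma range_proj_blaschke_continuous:
  "continuous_on {0..1} (\<lambda>t. range_proj (blaschke (t / 2)))"
  unfolding continuous_on_def
proof
  fix t :: real assume t: "t \<in> {0..1}"
  let ?p = "\<lambda>t. range_proj (blaschke (t / 2))"
  have "((\<lambda>s. ?p s - ?p t) \<longlongrightarrow> 0) (at t within {0..1})"
  proof (rule Lim_null_comparison)
    show "eventually (\<lambda>s. norm (?p s - ?p t) \<le> 2 * (exp (14 * \<bar>s / 2 - t / 2\<bar>) - 1)) (at t within {0..1})"
      unfolding eventually_at_filter
      by (intro always_eventually allI impI range_proj_blaschke_dist) (use t in auto)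
    have "((\<lambda>s. 2 * (exp (14 * \<bar>s / 2 - t / 2\<bar>) - 1)) \<longlongrightarrow> 2 * (exp (14 * \<bar>t / 2 - t / 2\<bar>) - 1)) (at t within {0..1})"
      by (intro tendsto_intros) auto
    thus "((\<lambda>s. 2 * (exp (14 * \<bar>s / 2 - t / 2\<bar>) - 1)) \<longlongrightarrow> 0) (at t within {0..1})" by simp
  qed
  thus "(?p \<longlongrightarrow> ?p t) (at t within {0..1})" by (simp add: LIM_zero_iff)
qed

lemma hinf_norm_ge:
  assumes "bounded_holomorphic u" "bounded_holomorphic v" "z \<in> ball 0 1"
  shows "cmod (u z - v z) \<le> hinf_norm (\<lambda>z. u z - v z)"
  unfolding hinf_norm_def
proof (rule cSUP_upper[OF assms(3)])
  obtain C D where C: "\<And>z. z \<in> ball 0 1 \<Longrightarrow> cmod (u z) \<le> C" and D: "\<And>z. z \<in> ball 0 1 \<Longrightarrow> cmod (v z) \<le> D"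
    using assms(1,2) bounded_holomorphicE by metis
  have "cmod (u z - v z) \<le> C + D" if "z \<in> ball 0 1" for z
    using norm_triangle_ineq4[of "u z" "v z"] C[OF that] D[OF that] by linarith
  thus "bdd_above ((\<lambda>z. cmod (u z - v z)) ` ball 0 1)" by (intro bdd_aboveI2[of _ _ "C + D"]) auto
qed

lemma blaschke_close_on_circle:
  assumes a: "a \<in> {0..1/2}" "b \<in> {0..1/2}"
    and close: "\<And>z. z \<in> ball 0 1 \<Longrightarrow> cmod (c * blaschke a z - d * blaschke b z) \<le> \<epsilon>"
    and z: "cmod z = 1" "z \<noteq> 1"
  shows "cmod (c * blaschke a z - d * blaschke b z) \<le> \<epsilon>"
proof -
  obtain r :: "nat \<Rightarrow> real" where r: "r \<longlonglongrightarrow> 1" "\<And>n. r n \<in> {0..<1}"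
    using radii_to_one by blast
  have b: "of_real (r n) * z \<in> ball 0 1" for n using r(2)[of n] z by (simp add: norm_mult)
  have "(\<lambda>n. of_real (r n) * z) \<longlonglongrightarrow> of_real 1 * z" by (intro tendsto_intros r)
  hence lim: "(\<lambda>n. blaschke s (of_real (r n) * z)) \<longlonglongrightarrow> blaschke s z" if "s \<in> {0..1/2}" for s
  proof (intro continuous_on_tendsto_compose[OF blaschke_continuous[OF that]])
    have sub: "ball 0 1 \<subseteq> cball 0 1 - {1 :: complex}" by auto
    show "eventually (\<lambda>n. of_real (r n) * z \<in> cball 0 1 - {1}) sequentially"
      by (intro always_eventually allI subsetD[OF sub] b)
  qed (use z in auto)
  have "(\<lambda>n. cmod (c * blaschke a (of_real (r n) * z) - d * blaschke b (of_real (r n) * z)))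
      \<longlonglongrightarrow> cmod (c * blaschke a z - d * blaschke b z)"
    by (intro tendsto_intros lim a)
  thus ?thesis by (rule Lim_bounded[of _ _ 0]) (use close[OF b] in auto)
qed

text \<open>Continuity fails at \<open>t = 0\<close>, along \<open>t = pi / m\<close>.\<close>

lemma no_continuous_cross_section:
  "\<not> (\<exists>\<phi>. cross_section (\<lambda>t. range_proj (blaschke (t / 2))) \<phi> \<and> hinf_continuous_on {0..1} \<phi>)"
proof
  assume "\<exists>\<phi>. cross_section (\<lambda>t. range_proj (blaschke (t / 2))) \<phi> \<and> hinf_continuous_on {0..1} \<phi>"
  then obtain \<phi> where cs: "cross_section (\<lambda>t. range_proj (blaschke (t / 2))) \<phi>"
    and cont: "hinf_continuous_on {0..1} \<phi>" by blast
  have inn: "inner_function (\<phi> t)" if "t \<in> {0..1}" for t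
    using cs that by (simp add: cross_section_def)
  have "\<exists>c. cmod c = 1 \<and> (\<forall>z\<in>ball 0 1. \<phi> t z = c * blaschke (t / 2) z)" if t: "t \<in> {0..1}" for t
  proof -
    have B: "inner_function (blaschke (t / 2))" using t by (intro blaschke_inner) auto
    have "mult_hardy (blaschke (t / 2)) = mult_hardy (\<phi> t)"
      using cs t range_proj_range[OF B] by (simp add: cross_section_def)
    from inner_function_unique[OF B inn[OF t] this] show ?thesis by metis
  qed
  then obtain c where c: "\<And>t. t \<in> {0..1} \<Longrightarrow> cmod (c t) = 1"
    "\<And>t z. t \<in> {0..1} \<Longrightarrow> z \<in> ball 0 1 \<Longrightarrow> \<phi> t z = c t * blaschke (t / 2) z" by metis
  have t_lim: "(\<lambda>m. pi / real m) \<longlonglongrightarrow> 0" by (rule lim_const_over_n)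
  have t_in: "eventually (\<lambda>m. pi / real m \<in> {0..1} \<and> pi / real m \<noteq> 0) sequentially"
    using eventually_ge_at_top[of 4] by eventually_elim (use pi_less_4 in \<open>auto simp: field_simps\<close>)
  have "filterlim (\<lambda>m. pi / real m) (at 0 within {0..1}) sequentially"
    unfolding filterlim_at using t_lim t_in by auto
  moreover have "((\<lambda>s. hinf_norm (\<lambda>z. \<phi> s z - \<phi> 0 z)) \<longlongrightarrow> 0) (at 0 within {0..1})"
    using cont by (simp add: hinf_continuous_on_def)
  ultimately have "(\<lambda>m. hinf_norm (\<lambda>z. \<phi> (pi / real m) z - \<phi> 0 z)) \<longlonglongrightarrow> 0"
    by (rule filterlim_compose[rotated])
  hence "eventually (\<lambda>m. hinf_norm (\<lambda>z. \<phi> (pi / real m) z - \<phi> 0 z) < 1/2) sequentially"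
    by (rule order_tendstoD) simp
  from eventually_happens[OF eventually_conj[OF this t_in]]
  obtain m where m: "hinf_norm (\<lambda>z. \<phi> (pi / real m) z - \<phi> 0 z) < 1/2"
    "pi / real m \<in> {0..1}" "pi / real m \<noteq> 0" by auto
  define t where "t = pi / real m"
  have t: "t \<in> {0..1}" "t / 2 \<in> {0..1/2}" using m by (auto simp: t_def)
  have "1 \<le> (1/2 :: real)"
  proof (rule blaschke_far[OF t(2) _ c(1)[OF t(1)] c(1)[of 0]])
    show "real m * (2 * (t / 2)) = pi" using m(3) by (auto simp: t_def)
    have close: "cmod (c t * blaschke (t / 2) z - c 0 * blaschke 0 z) \<le> 1/2" if z: "z \<in> ball 0 1" for z
    proof -
      have "cmod (\<phi> t z - \<phi> 0 z) \<le> 1/2"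
        using hinf_norm_ge[OF inner_bounded_holomorphic[OF inn[OF t(1)]] inner_bounded_holomorphic[OF inn[of 0]] z] m(1)
        by (simp add: t_def)
      thus ?thesis using c(2)[OF t(1) z] c(2)[OF _ z, of 0] by simp
    qed
    show "cmod (c t * blaschke (t / 2) z - c 0 * blaschke 0 z) \<le> 1/2" if "cmod z = 1" "z \<noteq> 1" for z
      by (rule blaschke_close_on_circle[OF t(2) _ close that]) auto
  qed auto
  thus False by simp
qed

theorem theorem3p5:
  shows "\<exists>p :: real \<Rightarrow> hardy \<Rightarrow>\<^sub>L hardy.
    continuous_on {0..1} p \<and>
    (\<forall>t\<in>{0..1}. nontrivial_projection (p t) \<and>
      mult_z ` range (blinfun_apply (p t)) \<subseteq> range (blinfun_apply (p t))) \<and>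
    \<not> (\<exists>\<phi>. cross_section p \<phi> \<and> hinf_continuous_on {0..1} \<phi>)"
proof (intro exI conjI ballI)
  fix t :: real assume "t \<in> {0..1}"
  hence t: "t / 2 \<in> {0..1/2}" by auto
  obtain z where z: "z \<in> ball 0 1" "blaschke (t / 2) z = 0" using blaschke_zero[OF t] by blast
  show "nontrivial_projection (range_proj (blaschke (t / 2)))"
    by (rule range_proj_nontrivial[OF blaschke_inner[OF t] z])
  show "mult_z ` range (blinfun_apply (range_proj (blaschke (t / 2)))) \<subseteq> range (blinfun_apply (range_proj (blaschke (t / 2))))"
    by (rule range_proj_invariant[OF blaschke_inner[OF t]])
qed (rule range_proj_blaschke_continuous no_continuous_cross_section)+

end
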